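(* Let $(R,\mathfrak m)$ be a Noetherian local ring and let $M$ be a finitely generated $R$-module with $\dim M=1$. Let $a$ be a parameter for $M$ (an element $a\in\mathfrak m$ with $\lambda(M/aM)<\infty$). Then $e_1((a),M)<0$ if and only if $M$ is not a Cohen-Macaulay module.
   Context: $\lambda(N)$ denotes the length of an $R$-module $N$. For an ideal $I$ of $R$ and a finitely generated $R$-module $M$ of dimension $d$ with $\lambda(M/IM)<\infty$, the function $n\mapsto \lambda(M/I^nM)$ agrees for all large $n$ with a polynomial $P_I(M,n)$ of degree $d$, written $$P_I(M,x)=e_0(I,M)\binom{x+d-1}{d}-e_1(I,M)\binom{x+d-2}{d-1}+\cdots+(-1)^d e_d(I,M),$$ with $e_i(I,M)\in\mathbb Z$. In particular, for $d=1$ one has $\lambda(M/I^nM)=e_0(I,M)\,n-e_1(I,M)$ for all large $n$. The integer $e_1(I,M)$ is called the Chern number of $I$ with respect to $M$. *)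

theory Defs
  imports
    "HOL-Computational_Algebra.Polynomial"
    "HOL-Library.Extended_Nat"
    "HOL-Algebra.Module"
    "HOL-Algebra.QuotRing"
    "HOL-Algebra.Ideal_Product"
    "HOL-Algebra.Ring_Divisibility"
begin

locale noetherian_local_ring =
  cring R + noetherian_ring R + max: maximalideal \<mm> R
  for \<mm> and R (structure) +
  assumes maximalideal_unique: "maximalideal J R \<Longrightarrow> J = \<mm>"


section \<open>Submodules, quotients, length\<close>

definition module_span ::
    "('a, 'r) ring_scheme \<Rightarrow> ('a, 'b, 'm) module_scheme \<Rightarrow> 'b set \<Rightarrow> 'b set" where
  "module_span R M S = \<Inter> {N. submodule N R M \<and> S \<subseteq> N}"

definition finitely_generated_module ::
    "('a, 'r) ring_scheme \<Rightarrow> ('a, 'b, 'm) module_scheme \<Rightarrow> bool" where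
  "finitely_generated_module R M \<longleftrightarrow>
     (\<exists>S. finite S \<and> S \<subseteq> carrier M \<and> module_span R M S = carrier M)"

text \<open>The submodule \<open>I M\<close>, for an ideal \<open>I\<close>.\<close>

definition ideal_smult ::
    "('a, 'r) ring_scheme \<Rightarrow> 'a set \<Rightarrow> ('a, 'b, 'm) module_scheme \<Rightarrow> 'b set" where
  "ideal_smult R I M = module_span R M {r \<odot>\<^bsub>M\<^esub> x | r x. r \<in> I \<and> x \<in> carrier M}"

text \<open>
  The quotient module \<open>M / N\<close>, whose elements are the cosets of \<open>N\<close>.  For a coset \<open>X = N + x\<close>,
  the set \<open>r X + N\<close> is the coset \<open>N + r x\<close>.  The fields \<open>mult\<close> and \<open>one\<close> are part of every
  module record, but have no meaning for modules.
\<close>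

definition quotient_module ::
    "('a, 'b, 'm) module_scheme \<Rightarrow> 'b set \<Rightarrow> ('a, 'b set) module" where
  "quotient_module M N =
     \<lparr> carrier = a_rcosets\<^bsub>M\<^esub> N,
       mult = undefined,
       one = undefined,
       zero = N,
       add = set_add M,
       smult = (\<lambda>r X. (\<lambda>x. r \<odot>\<^bsub>M\<^esub> x) ` X <+>\<^bsub>M\<^esub> N) \<rparr>"

definition module_length ::
    "('a, 'r) ring_scheme \<Rightarrow> ('a, 'b, 'm) module_scheme \<Rightarrow> enat" where
  "module_length R M =
     Sup {enat n | n. \<exists>N :: nat \<Rightarrow> 'b set.
       (\<forall>i\<le>n. submodule (N i) R M) \<and> (\<forall>i<n. N i \<subset> N (Suc i))}"


section \<open>Dimension, depth, Cohen-Macaulay modules\<close>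

definition krull_dim :: "('a, 'r) ring_scheme \<Rightarrow> enat" where
  "krull_dim R =
     Sup {enat n | n. \<exists>P :: nat \<Rightarrow> 'a set.
       (\<forall>i\<le>n. primeideal (P i) R) \<and> (\<forall>i<n. P i \<subset> P (Suc i))}"

definition annihilator ::
    "('a, 'r) ring_scheme \<Rightarrow> ('a, 'b, 'm) module_scheme \<Rightarrow> 'a set" where
  "annihilator R M = {r \<in> carrier R. \<forall>x\<in>carrier M. r \<odot>\<^bsub>M\<^esub> x = \<zero>\<^bsub>M\<^esub>}"

text \<open>
  The supremum of the empty set is 0 in \<^typ>\<open>enat\<close>, so the zero module gets dimension 0 here
  instead of the customary -1 or \<open>-\<infinity>\<close>.
\<close>

definition module_dim ::
    "('a, 'r) ring_scheme \<Rightarrow> ('a, 'b, 'm) module_scheme \<Rightarrow> enat" where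
  "module_dim R M = krull_dim (R Quot (annihilator R M))"

definition nonzerodivisor_on ::
    "('a, 'r) ring_scheme \<Rightarrow> ('a, 'b, 'm) module_scheme \<Rightarrow> 'a \<Rightarrow> bool" where
  "nonzerodivisor_on R M r \<longleftrightarrow>
     r \<in> carrier R \<and> (\<forall>x\<in>carrier M. r \<odot>\<^bsub>M\<^esub> x = \<zero>\<^bsub>M\<^esub> \<longrightarrow> x = \<zero>\<^bsub>M\<^esub>)"

definition regular_sequence ::
    "('a, 'r) ring_scheme \<Rightarrow> ('a, 'b, 'm) module_scheme \<Rightarrow> 'a list \<Rightarrow> bool" where
  "regular_sequence R M rs \<longleftrightarrow>
     (\<forall>i<length rs.
        nonzerodivisor_on R
          (quotient_module M (ideal_smult R (Idl\<^bsub>R\<^esub> (set (take i rs))) M)) (rs ! i)) \<and>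
     ideal_smult R (Idl\<^bsub>R\<^esub> (set rs)) M \<noteq> carrier M"

text \<open>The depth with respect to an ideal \<open>I\<close>; over a local ring, \<open>I\<close> is the maximal ideal.\<close>

definition module_depth ::
    "('a, 'r) ring_scheme \<Rightarrow> 'a set \<Rightarrow> ('a, 'b, 'm) module_scheme \<Rightarrow> enat" where
  "module_depth R I M = Sup {enat (length rs) | rs. set rs \<subseteq> I \<and> regular_sequence R M rs}"

definition cohen_macaulay_module ::
    "('a, 'r) ring_scheme \<Rightarrow> 'a set \<Rightarrow> ('a, 'b, 'm) module_scheme \<Rightarrow> bool" where
  "cohen_macaulay_module R \<mm> M \<longleftrightarrow>
     carrier M = {\<zero>\<^bsub>M\<^esub>} \<or> module_depth R \<mm> M = module_dim R M"


section \<open>Hilbert polynomial and Hilbert coefficients\<close>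

text \<open>Powers of \<open>I\<close> are taken in the multiplicative monoid of ideals, so \<open>I\<^sup>0 = R\<close>.\<close>

definition hilbert_poly ::
    "('a, 'r) ring_scheme \<Rightarrow> 'a set \<Rightarrow> ('a, 'b, 'm) module_scheme \<Rightarrow> rat poly" where
  "hilbert_poly R I M =
     (THE P. \<forall>\<^sub>F n in sequentially. \<exists>k.
        module_length R (quotient_module M (ideal_smult R (I [^]\<^bsub>ideals_set R\<^esub> n) M)) = enat k \<and>
        poly P (of_nat n) = of_nat k)"

text \<open>
  \<open>hilbert_coeff R I M i\<close> is \<open>e\<^sub>i(I, M)\<close>.  The condition that \<open>e i = 0\<close> for \<open>i > d\<close> only serves to
  make the sequence \<open>e\<close> unique.
\<close>

definition hilbert_coeff ::
    "('a, 'r) ring_scheme \<Rightarrow> 'a set \<Rightarrow> ('a, 'b, 'm) module_scheme \<Rightarrow> nat \<Rightarrow> int" where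
  "hilbert_coeff R I M =
     (let d = the_enat (module_dim R M) in
      THE e. (\<forall>i>d. e i = 0) \<and>
        (\<forall>x. poly (hilbert_poly R I M) x =
           (\<Sum>i\<le>d. (- 1) ^ i * of_int (e i) * ((x + of_nat (d - i) - 1) gchoose (d - i)))))"


section \<open>Well-definedness of the quotient module\<close>

lemma submodule_abelian_subgroup:
  assumes "module R M" "submodule N R M"
  shows "abelian_subgroup N M"
  using assms by (intro abelian_subgroupI3 additive_subgroup.intro)
    (auto simp: module_def submodule_def)

lemma quotient_module_smult:
  assumes "module R M" "submodule N R M" "r \<in> carrier R" "x \<in> carrier M"
  shows "r \<odot>\<^bsub>quotient_module M N\<^esub> (N +>\<^bsub>M\<^esub> x) = N +>\<^bsub>M\<^esub> (r \<odot>\<^bsub>M\<^esub> x)"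
proof -
  interpret module R M by fact
  interpret N: submodule N R M by fact
  interpret A: abelian_subgroup N M by (rule submodule_abelian_subgroup) fact+
  have 0: "\<zero>\<^bsub>M\<^esub> \<in> N" by (rule A.zero_closed)
  have Nc: "n \<in> carrier M" if "n \<in> N" for n using that A.a_Hcarr by blast
  show ?thesis
  proof (intro equalityI subsetI)
    fix y assume "y \<in> r \<odot>\<^bsub>quotient_module M N\<^esub> (N +>\<^bsub>M\<^esub> x)"
    then obtain n m where nm: "n \<in> N" "m \<in> N" "y = r \<odot>\<^bsub>M\<^esub> (n \<oplus>\<^bsub>M\<^esub> x) \<oplus>\<^bsub>M\<^esub> m"
      by (auto simp: quotient_module_def set_add_def' a_r_coset_def')
    have "y = (r \<odot>\<^bsub>M\<^esub> n \<oplus>\<^bsub>M\<^esub> m) \<oplus>\<^bsub>M\<^esub> r \<odot>\<^bsub>M\<^esub> x"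
      using nm assms(3,4) Nc by (simp add: smult_r_distr M.a_ac)
    moreover have "r \<odot>\<^bsub>M\<^esub> n \<oplus>\<^bsub>M\<^esub> m \<in> N"
      using nm assms(3) by (simp add: A.a_closed)
    ultimately show "y \<in> N +>\<^bsub>M\<^esub> (r \<odot>\<^bsub>M\<^esub> x)" by (auto simp: a_r_coset_def')
  next
    fix y assume "y \<in> N +>\<^bsub>M\<^esub> (r \<odot>\<^bsub>M\<^esub> x)"
    then obtain m where m: "m \<in> N" "y = m \<oplus>\<^bsub>M\<^esub> r \<odot>\<^bsub>M\<^esub> x"
      by (auto simp: a_r_coset_def')
    have "y = r \<odot>\<^bsub>M\<^esub> (\<zero>\<^bsub>M\<^esub> \<oplus>\<^bsub>M\<^esub> x) \<oplus>\<^bsub>M\<^esub> m"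
      using m assms(3,4) Nc by (simp add: M.a_ac)
    then show "y \<in> r \<odot>\<^bsub>quotient_module M N\<^esub> (N +>\<^bsub>M\<^esub> x)"
      using 0 m(1) by (auto simp: quotient_module_def set_add_def' a_r_coset_def')
  qed
qed

lemma quotient_module_is_module:
  assumes "module R M" "submodule N R M"
  shows "module R (quotient_module M N)"
proof -
  interpret module R M by fact
  interpret A: abelian_subgroup N M by (rule submodule_abelian_subgroup) fact+
  let ?Q = "quotient_module M N"
  have car: "\<exists>x\<in>carrier M. X = N +>\<^bsub>M\<^esub> x" if "X \<in> carrier ?Q" for X
    using that by (auto simp: quotient_module_def A_RCOSETS_def')
  have in_car: "N +>\<^bsub>M\<^esub> x \<in> carrier ?Q" if "x \<in> carrier M" for x
    using that by (auto simp: quotient_module_def A_RCOSETS_def')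
  have add: "(N +>\<^bsub>M\<^esub> x) \<oplus>\<^bsub>?Q\<^esub> (N +>\<^bsub>M\<^esub> y) = N +>\<^bsub>M\<^esub> (x \<oplus>\<^bsub>M\<^esub> y)"
    if "x \<in> carrier M" "y \<in> carrier M" for x y
    using A.a_rcos_sum[OF that] by (simp add: quotient_module_def)
  have zero: "\<zero>\<^bsub>?Q\<^esub> = N +>\<^bsub>M\<^esub> \<zero>\<^bsub>M\<^esub>"
    by (simp add: quotient_module_def M.a_coset_add_zero A.a_subset)
  note sm = quotient_module_smult[OF assms]
  have ab: "abelian_group ?Q"
  proof (rule abelian_groupI)
    fix X assume "X \<in> carrier ?Q"
    then obtain x where x: "x \<in> carrier M" "X = N +>\<^bsub>M\<^esub> x" using car by blast
    then have "(N +>\<^bsub>M\<^esub> (\<ominus>\<^bsub>M\<^esub> x)) \<oplus>\<^bsub>?Q\<^esub> X = \<zero>\<^bsub>?Q\<^esub>"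
      by (simp add: add zero M.l_neg)
    then show "\<exists>Y\<in>carrier ?Q. Y \<oplus>\<^bsub>?Q\<^esub> X = \<zero>\<^bsub>?Q\<^esub>"
      using x in_car by blast
  qed (auto dest!: car simp: add zero in_car M.a_ac)
  show ?thesis
    by (rule moduleI[OF R.is_cring ab])
       (auto dest!: car simp: sm add in_car smult_l_distr smult_r_distr smult_assoc1)
qed

end

theory Submission
  imports Defs
begin

text \<open>
  Let \<open>W\<^sub>i = (0 : a\<^sup>i)\<close>. These submodules increase, and since \<open>M\<close> is Noetherian they are equal
  to some \<open>W\<close> from an index \<open>c\<close> on. Both sides of the equivalence say that \<open>W \<noteq> 0\<close>, that is,
  that \<open>a\<close> is a zerodivisor on \<open>M\<close>.

  For the Chern number, multiplication by \<open>a\<^sup>i\<close> identifies \<open>M/(aM + W\<^sub>i)\<close> with \<open>a\<^sup>iM/a\<^sup>i\<^sup>+\<^sup>1M\<close>.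
  So \<open>\<lambda>(M/a\<^sup>nM)\<close> is the sum of the numbers \<open>l i = \<lambda>(M/(aM + W\<^sub>i))\<close> over \<open>i < n\<close>. The \<open>l i\<close>
  decrease to \<open>e\<^sub>0 = l c\<close>, and \<open>e\<^sub>1\<close> is the sum of the numbers \<open>e\<^sub>0 - l i \<le> 0\<close> over \<open>i < c\<close>.
  Hence \<open>e\<^sub>1 \<le> 0\<close>, with equality if and only if \<open>l 0 = l c\<close>, which means \<open>W \<subseteq> aM\<close>. In that case
  every element of \<open>W\<close> is \<open>a y\<close> with \<open>y\<close> again in \<open>W\<close>, so \<open>W = aW\<close> and \<open>W = 0\<close> by Nakayama's
  lemma (\<open>hilbert_function_of_parameter\<close>, \<open>e1_neg_iff_zerodivisor\<close>).

  On the other side, \<open>M\<close> is not zero, because its dimension is 1, so \<open>M\<close> is Cohen-Macaulay if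
  and only if its depth is 1. Finiteness of \<open>\<lambda>(M/aM)\<close> and Nakayama's lemma show that each \<open>b \<in>
  \<mm>\<close> has a power that maps \<open>M\<close> into \<open>aM\<close> (\<open>power_scaled_subset\<close>). If some \<open>b \<in> \<mm>\<close> is a
  nonzerodivisor, it follows that \<open>a\<close> is one (\<open>nonzerodivisor_parameter\<close>). If there were a
  regular sequence of length two, powers of its members would give a regular sequence \<open>s, t\<close>
  with \<open>sM, tM \<subseteq> aM\<close>, and comparing \<open>t(sx)\<close> with \<open>s(tx)\<close> gives \<open>M = aM\<close> (\<open>no_regular_pair\<close>). So
  the depth is 1 exactly when \<open>a\<close> is a nonzerodivisor (\<open>depth_eq_1_iff\<close>).

  Lengths of subquotients \<open>C/A\<close> are handled as lengths of the intervals of submodules between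
  \<open>A\<close> and \<open>C\<close>, so that no quotient module occurs except in the translation of the statement.
\<close>

section \<open>Lengths of intervals of submodules\<close>

text \<open>
  The length of a module is the chain length of its set of submodules; families of subsets are
  used in place of modules so that lengths can be compared along strictly monotone maps.
\<close>

definition chain_length :: "'c set set \<Rightarrow> enat" where
  "chain_length S =
     Sup {enat n | n. \<exists>N :: nat \<Rightarrow> 'c set. (\<forall>i\<le>n. N i \<in> S) \<and> (\<forall>i<n. N i \<subset> N (Suc i))}"

text \<open>
  An initial part of a chain is a chain, so all lengths up to the supremum are attained.
\<close>

lemma enat_le_chain_length_iff:
  assumes "S \<noteq> {}"
  shows "enat n \<le> chain_length S \<longleftrightarrow>
    (\<exists>N :: nat \<Rightarrow> 'c set. (\<forall>i\<le>n. N i \<in> S) \<and> (\<forall>i<n. N i \<subset> N (Suc i)))"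
    (is "_ \<longleftrightarrow> (\<exists>N. ?chain n N)")
proof
  assume le: "enat n \<le> chain_length S"
  show "\<exists>N. ?chain n N"
  proof (rule ccontr)
    assume no: "\<nexists>N. ?chain n N"
    have "m \<le> n - 1" if "?chain m N" for m N
    proof (rule ccontr)
      assume "\<not> m \<le> n - 1"
      then have "n \<le> m" by simp
      with that have "?chain n N" by (meson le_trans less_le_trans)
      with no show False by blast
    qed
    then have "chain_length S \<le> enat (n - 1)"
      unfolding chain_length_def by (intro Sup_least) (use enat_ord_simps(1) in blast)
    with le have "n \<le> n - 1" by (metis enat_ord_simps(1) order_trans)
    then have "n = 0" by simp
    with no assms show False by auto
  qed
next
  assume "\<exists>N. ?chain n N"
  then show "enat n \<le> chain_length S"
    unfolding chain_length_def by (intro Sup_upper) blast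
qed

lemma enat_le_iff_nat:
  fixes x y :: enat
  assumes "\<And>n. enat n \<le> x \<Longrightarrow> enat n \<le> y"
  shows "x \<le> y"
proof (cases x)
  case (enat k)
  then show ?thesis using assms[of k] by simp
next
  case infinity
  show ?thesis
  proof (cases y)
    case (enat k)
    then show ?thesis using assms[of "Suc k"] infinity by simp
  qed simp
qed

lemma chain_length_mono_map:
  fixes f :: "'c set \<Rightarrow> 'd set"
  assumes "\<And>K. K \<in> S \<Longrightarrow> f K \<in> T"
    and "\<And>K L. K \<in> S \<Longrightarrow> L \<in> S \<Longrightarrow> K \<subset> L \<Longrightarrow> f K \<subset> f L"
  shows "chain_length S \<le> chain_length T"
  unfolding chain_length_def
proof (rule Sup_subset_mono, clarify)
  fix n and N :: "nat \<Rightarrow> 'c set"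
  assume "\<forall>i\<le>n. N i \<in> S" "\<forall>i<n. N i \<subset> N (Suc i)"
  then have "(\<forall>i\<le>n. f (N i) \<in> T) \<and> (\<forall>i<n. f (N i) \<subset> f (N (Suc i)))"
    using assms by (auto simp: Suc_le_eq less_imp_le)
  then show "\<exists>m. enat n = enat m \<and> (\<exists>N'. (\<forall>i\<le>m. N' i \<in> T) \<and> (\<forall>i<m. N' i \<subset> N' (Suc i)))"
    by (intro exI[of _ n] conjI refl exI[of _ "\<lambda>i. f (N i)"]) auto
qed

definition interval_length ::
    "('a, 'r) ring_scheme \<Rightarrow> ('a, 'b, 'm) module_scheme \<Rightarrow> 'b set \<Rightarrow> 'b set \<Rightarrow> enat" where
  "interval_length R M A C = chain_length {K. submodule K R M \<and> A \<subseteq> K \<and> K \<subseteq> C}"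

lemma interval_length_mono:
  assumes "A' \<subseteq> A" "C \<subseteq> C'"
  shows "interval_length R M A C \<le> interval_length R M A' C'"
  unfolding interval_length_def
  by (rule chain_length_mono_map[where f = "\<lambda>K. K"]) (use assms in auto)

lemma enat_le_interval_length_iff:
  assumes "submodule A R M" "A \<subseteq> C"
  shows "enat n \<le> interval_length R M A C \<longleftrightarrow>
    (\<exists>N. (\<forall>i\<le>n. submodule (N i) R M \<and> A \<subseteq> N i \<and> N i \<subseteq> C) \<and> (\<forall>i<n. N i \<subset> N (Suc i)))"
proof -
  have "{K. submodule K R M \<and> A \<subseteq> K \<and> K \<subseteq> C} \<noteq> {}" using assms by blast
  from enat_le_chain_length_iff[OF this] show ?thesis
    unfolding interval_length_def by simp
qed

lemma interval_length_strict:
  assumes "submodule A R M" "submodule Y R M" "A \<subseteq> X" "X \<subset> Y"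
  shows "interval_length R M A X + 1 \<le> interval_length R M A Y"
proof (cases "interval_length R M A X")
  case infinity
  then show ?thesis using interval_length_mono[of A A X Y R M] assms by (simp add: psubset_imp_subset)
next
  case (enat n)
  then have "enat n \<le> interval_length R M A X" by simp
  then obtain N where N: "\<forall>i\<le>n. submodule (N i) R M \<and> A \<subseteq> N i \<and> N i \<subseteq> X"
      "\<forall>i<n. N i \<subset> N (Suc i)"
    unfolding enat_le_interval_length_iff[OF assms(1,3)] by blast
  let ?N = "\<lambda>i. if i \<le> n then N i else Y"
  have "enat (Suc n) \<le> interval_length R M A Y"
    unfolding enat_le_interval_length_iff[OF assms(1) order_trans[OF assms(3) psubset_imp_subset[OF assms(4)]]]
  proof (intro exI[of _ ?N] conjI allI impI)
    fix i assume "i < Suc n"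
    then show "?N i \<subset> ?N (Suc i)"
      using N assms(4) by (cases "i = n") (auto dest!: spec[of _ n] intro: psubset_subset_trans)
  next
    fix i assume "i \<le> Suc n"
    show "submodule (?N i) R M" "A \<subseteq> ?N i" "?N i \<subseteq> Y"
      using N(1) assms by (auto simp: psubset_eq subset_iff)
  qed
  then show ?thesis using enat by (simp add: one_enat_def)
qed

lemma interval_length_eq_0D:
  assumes "submodule A R M" "submodule C R M" "A \<subseteq> C" "interval_length R M A C = 0"
  shows "A = C"
proof (rule ccontr)
  assume "A \<noteq> C"
  then have "interval_length R M A A + 1 \<le> interval_length R M A C"
    using assms by (intro interval_length_strict) auto
  with assms(4) show False by simp
qed

text \<open>
  A chain in the lower interval, followed by the members after the first of a chain in the upper
  one, is again a chain.
\<close>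

lemma interval_length_concat:
  assumes "submodule A R M" "submodule B R M" "A \<subseteq> B" "B \<subseteq> C"
  shows "interval_length R M A B + interval_length R M B C \<le> interval_length R M A C"
proof (rule enat_le_iff_nat)
  have AC: "A \<subseteq> C" using assms by blast
  have concat: "enat (n + m) \<le> interval_length R M A C"
    if nm: "enat n \<le> interval_length R M A B" "enat m \<le> interval_length R M B C" for n m
  proof -
    obtain N where N: "\<forall>i\<le>n. submodule (N i) R M \<and> A \<subseteq> N i \<and> N i \<subseteq> B"
        "\<forall>i<n. N i \<subset> N (Suc i)"
      using enat_le_interval_length_iff[OF assms(1,3), THEN iffD1, OF nm(1)]
      by (elim exE conjE)
    obtain L where L: "\<forall>i\<le>m. submodule (L i) R M \<and> B \<subseteq> L i \<and> L i \<subseteq> C"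
        "\<forall>i<m. L i \<subset> L (Suc i)"
      using enat_le_interval_length_iff[OF assms(2,4), THEN iffD1, OF nm(2)]
      by (elim exE conjE)
    let ?N = "\<lambda>i. if i \<le> n then N i else L (i - n)"
    show ?thesis
      unfolding enat_le_interval_length_iff[OF assms(1) AC]
    proof (intro exI[of _ ?N] conjI allI impI)
      fix i assume i: "i < n + m"
      consider "i < n" | "i = n" | "i > n" by linarith
      then show "?N i \<subset> ?N (Suc i)"
      proof cases
        case 2
        then have "N n \<subseteq> B" "B \<subseteq> L 0" "L 0 \<subset> L (Suc 0)" using N L i by auto
        with 2 show ?thesis by auto
      next
        case 3
        then show ?thesis using L(2) i by (simp add: Suc_diff_le)
      qed (use N in auto)
    next
      fix i assume "i \<le> n + m"
      then have "i \<le> n \<or> i - n \<le> m" by linarith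
      then have "submodule (?N i) R M \<and> A \<subseteq> ?N i \<and> ?N i \<subseteq> C"
      proof (cases "i \<le> n")
        case True
        then have "submodule (N i) R M \<and> A \<subseteq> N i \<and> N i \<subseteq> B" using N(1) by blast
        with True assms(4) show ?thesis by auto
      next
        case False
        with \<open>i \<le> n \<or> i - n \<le> m\<close> L(1)
        have "submodule (L (i - n)) R M \<and> B \<subseteq> L (i - n) \<and> L (i - n) \<subseteq> C" by blast
        with False assms(3) show ?thesis by auto
      qed
      then show "submodule (?N i) R M" "A \<subseteq> ?N i" "?N i \<subseteq> C" by blast+
    qed
  qed
  fix k assume k: "enat k \<le> interval_length R M A B + interval_length R M B C"
  show "enat k \<le> interval_length R M A C"
  proof (cases "interval_length R M A B")
    case infinity
    then show ?thesis using interval_length_mono[of A A B C R M] assms by auto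
  next
    case (enat n)
    have "enat (k - n) \<le> interval_length R M B C"
      using k enat by (cases "interval_length R M B C") auto
    then have "enat (n + (k - n)) \<le> interval_length R M A C"
      by (intro concat) (simp_all add: enat)
    moreover have "enat k \<le> enat (n + (k - n))" by simp
    ultimately show ?thesis by (rule order_trans[rotated])
  qed
qed

context module
begin

lemma submodule_zero: "submodule {\<zero>\<^bsub>M\<^esub>} R M"
  by (rule submoduleI) auto

lemma submodule_has_zero: "submodule N R M \<Longrightarrow> \<zero>\<^bsub>M\<^esub> \<in> N"
  by (metis submodule.axioms(1) subgroup.one_closed monoid.select_convs(2))

lemma submodule_diff:
  assumes "submodule N R M" "x \<in> N" "y \<in> N"
  shows "x \<ominus>\<^bsub>M\<^esub> y \<in> N"
  using submoduleE[OF assms(1)] assms by (simp add: a_minus_def)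

lemma add_minus_cancel_right:
  "p \<in> carrier M \<Longrightarrow> q \<in> carrier M \<Longrightarrow> (p \<oplus>\<^bsub>M\<^esub> q) \<ominus>\<^bsub>M\<^esub> q = p"
  by (simp add: a_minus_def M.a_assoc M.r_neg)

lemma add_minus_cancel_left:
  "p \<in> carrier M \<Longrightarrow> q \<in> carrier M \<Longrightarrow> (p \<oplus>\<^bsub>M\<^esub> q) \<ominus>\<^bsub>M\<^esub> p = q"
  using add_minus_cancel_right[of q p] by (simp add: M.a_comm)

lemma submodule_inter:
  assumes "submodule N R M" "submodule K R M"
  shows "submodule (N \<inter> K) R M"
  by (rule submoduleI)
     (use submoduleE[OF assms(1)] submoduleE[OF assms(2)] submodule_has_zero assms in auto)

lemma set_add_memI: "x \<in> N \<Longrightarrow> y \<in> K \<Longrightarrow> x \<oplus>\<^bsub>M\<^esub> y \<in> N <+>\<^bsub>M\<^esub> K"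
  unfolding set_add_def' by blast

lemma set_add_memE:
  assumes "z \<in> N <+>\<^bsub>M\<^esub> K"
  obtains x y where "x \<in> N" "y \<in> K" "z = x \<oplus>\<^bsub>M\<^esub> y"
  using assms unfolding set_add_def' by blast

lemma submodule_add:
  assumes "submodule N R M" "submodule K R M"
  shows "submodule (N <+>\<^bsub>M\<^esub> K) R M"
proof -
  note N = submoduleE[OF assms(1)] and K = submoduleE[OF assms(2)]
  show ?thesis
  proof (rule submoduleI)
    show "N <+>\<^bsub>M\<^esub> K \<subseteq> carrier M" using N(1) K(1) by (auto simp: set_add_def')
    have "\<zero>\<^bsub>M\<^esub> \<oplus>\<^bsub>M\<^esub> \<zero>\<^bsub>M\<^esub> \<in> N <+>\<^bsub>M\<^esub> K"
      using assms submodule_has_zero unfolding set_add_def' by blast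
    then show "\<zero>\<^bsub>M\<^esub> \<in> N <+>\<^bsub>M\<^esub> K" by simp
  next
    fix z assume "z \<in> N <+>\<^bsub>M\<^esub> K"
    then obtain x y where xy: "x \<in> N" "y \<in> K" "z = x \<oplus>\<^bsub>M\<^esub> y" by (rule set_add_memE)
    have xy': "x \<in> carrier M" "y \<in> carrier M" using xy N(1) K(1) by auto
    have "\<ominus>\<^bsub>M\<^esub> z = \<ominus>\<^bsub>M\<^esub> x \<oplus>\<^bsub>M\<^esub> \<ominus>\<^bsub>M\<^esub> y" using xy xy' by (simp add: M.minus_add)
    then show "\<ominus>\<^bsub>M\<^esub> z \<in> N <+>\<^bsub>M\<^esub> K" using set_add_memI[OF N(3)[OF xy(1)] K(3)[OF xy(2)]] by simp
  next
    fix r z assume r: "r \<in> carrier R" and z: "z \<in> N <+>\<^bsub>M\<^esub> K"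
    from z obtain x y where xy: "x \<in> N" "y \<in> K" "z = x \<oplus>\<^bsub>M\<^esub> y" by (rule set_add_memE)
    have xy': "x \<in> carrier M" "y \<in> carrier M" using xy N(1) K(1) by auto
    have "r \<odot>\<^bsub>M\<^esub> z = r \<odot>\<^bsub>M\<^esub> x \<oplus>\<^bsub>M\<^esub> r \<odot>\<^bsub>M\<^esub> y" using xy xy' r by (simp add: smult_r_distr)
    then show "r \<odot>\<^bsub>M\<^esub> z \<in> N <+>\<^bsub>M\<^esub> K" using set_add_memI[OF N(4)[OF r xy(1)] K(4)[OF r xy(2)]] by simp
  next
    fix z z' assume "z \<in> N <+>\<^bsub>M\<^esub> K" "z' \<in> N <+>\<^bsub>M\<^esub> K"
    then obtain x y x' y' where xy: "x \<in> N" "y \<in> K" "z = x \<oplus>\<^bsub>M\<^esub> y"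
      "x' \<in> N" "y' \<in> K" "z' = x' \<oplus>\<^bsub>M\<^esub> y'" by (metis set_add_memE)
    have "x \<in> carrier M" "y \<in> carrier M" "x' \<in> carrier M" "y' \<in> carrier M"
      using xy N(1) K(1) by auto
    then have "z \<oplus>\<^bsub>M\<^esub> z' = (x \<oplus>\<^bsub>M\<^esub> x') \<oplus>\<^bsub>M\<^esub> (y \<oplus>\<^bsub>M\<^esub> y')" using xy by (simp add: M.a_ac)
    then show "z \<oplus>\<^bsub>M\<^esub> z' \<in> N <+>\<^bsub>M\<^esub> K" using set_add_memI[OF N(5)[OF xy(1,4)] K(5)[OF xy(2,5)]] by simp
  qed
qed

lemma set_add_upper:
  assumes "submodule N R M" "submodule K R M"
  shows "N \<subseteq> N <+>\<^bsub>M\<^esub> K" "K \<subseteq> N <+>\<^bsub>M\<^esub> K"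
proof -
  note N = submoduleE(1)[OF assms(1)] and K = submoduleE(1)[OF assms(2)]
  show "N \<subseteq> N <+>\<^bsub>M\<^esub> K"
  proof
    fix x assume x: "x \<in> N"
    then have "x \<oplus>\<^bsub>M\<^esub> \<zero>\<^bsub>M\<^esub> \<in> N <+>\<^bsub>M\<^esub> K"
      using submodule_has_zero[OF assms(2)] unfolding set_add_def' by blast
    then show "x \<in> N <+>\<^bsub>M\<^esub> K" using x N by (simp add: subsetD)
  qed
  show "K \<subseteq> N <+>\<^bsub>M\<^esub> K"
  proof
    fix x assume x: "x \<in> K"
    then have "\<zero>\<^bsub>M\<^esub> \<oplus>\<^bsub>M\<^esub> x \<in> N <+>\<^bsub>M\<^esub> K"
      using submodule_has_zero[OF assms(1)] unfolding set_add_def' by blast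
    then show "x \<in> N <+>\<^bsub>M\<^esub> K" using x K by (simp add: subsetD)
  qed
qed

lemma set_add_least:
  assumes "submodule L R M" "N \<subseteq> L" "K \<subseteq> L"
  shows "N <+>\<^bsub>M\<^esub> K \<subseteq> L"
  using submoduleE(5)[OF assms(1)] assms(2,3) by (auto simp: set_add_def')

lemma interval_length_self:
  assumes C: "submodule C R M"
  shows "interval_length R M C C = 0"
proof -
  have "interval_length R M C C \<le> 0"
  proof (rule enat_le_iff_nat)
    fix n assume "enat n \<le> interval_length R M C C"
    then obtain N where N: "\<forall>i\<le>n. submodule (N i) R M \<and> C \<subseteq> N i \<and> N i \<subseteq> C"
        "\<forall>i<n. N i \<subset> N (Suc i)"
      unfolding enat_le_interval_length_iff[OF C order_refl] by blast
    have "n = 0"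
    proof (rule ccontr)
      assume "n \<noteq> 0"
      then have "N 0 \<subset> N (Suc 0)" "C \<subseteq> N 0" "N (Suc 0) \<subseteq> C" using N by auto
      then show False by blast
    qed
    then show "enat n \<le> 0" by (simp add: zero_enat_def)
  qed
  then show ?thesis by simp
qed

text \<open>
  The consequence of the modular law that makes length additive: a strict step in a chain stays
  strict after intersecting with \<open>B\<close> or after adding \<open>B\<close>.
\<close>

lemma modular_cancel:
  assumes "submodule B R M" "submodule N R M" "submodule N' R M"
    and "N \<subseteq> N'" "N \<inter> B = N' \<inter> B" "N' \<subseteq> N <+>\<^bsub>M\<^esub> B"
  shows "N = N'"
proof
  show "N' \<subseteq> N"
  proof
    fix x assume x: "x \<in> N'"
    then obtain n b where nb: "n \<in> N" "b \<in> B" "x = n \<oplus>\<^bsub>M\<^esub> b"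
      using assms(6) by (auto simp: set_add_def')
    have c: "n \<in> carrier M" "b \<in> carrier M" "x \<in> carrier M"
      using nb x submoduleE(1)[OF assms(2)] submoduleE(1)[OF assms(1)] submoduleE(1)[OF assms(3)] by auto
    have "x \<ominus>\<^bsub>M\<^esub> n = b" using nb(3) c
      by (metis M.add.inv_solve_right M.add.m_comm M.minus_eq)
    moreover have "x \<ominus>\<^bsub>M\<^esub> n \<in> N'" using submodule_diff[OF assms(3)] x nb assms(4) by blast
    ultimately have "b \<in> N" using nb assms(5) by blast
    then show "x \<in> N" using nb submoduleE(5)[OF assms(2)] by blast
  qed
qed (rule assms(4))

text \<open>
  Additivity of length in short exact sequences. A chain \<open>N i\<close> between \<open>A\<close> and \<open>C\<close> gives the
  chains \<open>N i \<inter> B\<close> and \<open>N i + B\<close> in the two parts, and by \<open>modular_cancel\<close> each step is strict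
  in at least one of them.
\<close>

lemma interval_length_add:
  assumes A: "submodule A R M" and B: "submodule B R M" and C: "submodule C R M"
    and AB: "A \<subseteq> B" and BC: "B \<subseteq> C"
  shows "interval_length R M A C = interval_length R M A B + interval_length R M B C"
proof (rule antisym)
  show "interval_length R M A C \<le> interval_length R M A B + interval_length R M B C"
  proof (rule enat_le_iff_nat)
    have AC: "A \<subseteq> C" using AB BC by blast
    fix k assume "enat k \<le> interval_length R M A C"
    then obtain N where N: "\<And>i. i \<le> k \<Longrightarrow> submodule (N i) R M"
        "\<And>i. i \<le> k \<Longrightarrow> A \<subseteq> N i" "\<And>i. i \<le> k \<Longrightarrow> N i \<subseteq> C" "\<And>i. i < k \<Longrightarrow> N i \<subset> N (Suc i)"
      unfolding enat_le_interval_length_iff[OF A AC] by blast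
    let ?f = "\<lambda>i. interval_length R M A (N i \<inter> B)"
    let ?g = "\<lambda>i. interval_length R M B (N i <+>\<^bsub>M\<^esub> B)"
    \<comment> \<open>the first \<open>i\<close> steps of the chain are accounted for in one of the two parts\<close>
    have "enat i \<le> ?f i + ?g i" if "i \<le> k" for i
      using that
    proof (induction i)
      case 0
      then show ?case by (simp add: zero_enat_def[symmetric])
    next
      case (Suc i)
      then have ik: "i \<le> k" "i < k" and IH: "enat i \<le> ?f i + ?g i" by auto
      note Ni = N(1)[OF ik(1)] and NS = N(1)[OF Suc.prems]
      have sub: "N i \<subset> N (Suc i)" by (rule N(4)[OF ik(2)])
      have le1: "N i \<inter> B \<subseteq> N (Suc i) \<inter> B" using sub by blast
      have le2: "N i <+>\<^bsub>M\<^esub> B \<subseteq> N (Suc i) <+>\<^bsub>M\<^esub> B"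
        using sub by (auto elim!: set_add_memE intro: set_add_memI)
      have m1: "?f i \<le> ?f (Suc i)" by (rule interval_length_mono[OF order_refl le1])
      have m2: "?g i \<le> ?g (Suc i)" by (rule interval_length_mono[OF order_refl le2])
      have strict: "?f i + 1 \<le> ?f (Suc i) \<or> ?g i + 1 \<le> ?g (Suc i)"
      proof (cases "N i \<inter> B = N (Suc i) \<inter> B")
        case True
        have "\<not> N (Suc i) \<subseteq> N i <+>\<^bsub>M\<^esub> B"
          using modular_cancel[OF B Ni NS _ True] sub by blast
        then have "N i <+>\<^bsub>M\<^esub> B \<subset> N (Suc i) <+>\<^bsub>M\<^esub> B"
          using le2 set_add_upper(1)[OF NS B] by blast
        then have "?g i + 1 \<le> ?g (Suc i)"
          by (intro interval_length_strict B submodule_add[OF NS B] set_add_upper(2)[OF Ni B])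
        then show ?thesis ..
      next
        case False
        then have "N i \<inter> B \<subset> N (Suc i) \<inter> B" using le1 by blast
        moreover have "A \<subseteq> N i \<inter> B" using N(2)[OF ik(1)] AB by blast
        ultimately have "?f i + 1 \<le> ?f (Suc i)"
          by (intro interval_length_strict A submodule_inter[OF NS B])
        then show ?thesis ..
      qed
      have "?f i + ?g i + 1 \<le> ?f (Suc i) + ?g (Suc i)"
        using strict
      proof
        assume "?f i + 1 \<le> ?f (Suc i)"
        from add_mono[OF this m2] show ?thesis by (simp add: ac_simps)
      next
        assume "?g i + 1 \<le> ?g (Suc i)"
        from add_mono[OF m1 this] show ?thesis by (simp add: ac_simps)
      qed
      from IH this have "enat i + 1 \<le> ?f (Suc i) + ?g (Suc i)"
        by (rule order_trans[OF add_right_mono])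
      then show ?case by (simp add: one_enat_def)
    qed
    then have "enat k \<le> ?f k + ?g k" by simp
    also have "\<dots> \<le> interval_length R M A B + interval_length R M B C"
      using set_add_least[OF C N(3)[of k] BC] by (intro add_mono interval_length_mono) auto
    finally show "enat k \<le> interval_length R M A B + interval_length R M B C" .
  qed
qed (rule interval_length_concat[OF A B AB BC])

end


section \<open>Multiples and colon submodules\<close>

context module
begin

text \<open>
  \<open>scaled b K\<close> is usually written \<open>bK\<close>, and \<open>colon K b\<close> is \<open>(K :\<^sub>M b)\<close>. In particular \<open>colon {0}
  b\<close> is the kernel of multiplication by \<open>b\<close>; since \<open>b\<close> is a nonzerodivisor on \<open>M/N\<close> if and only
  if \<open>colon N b \<subseteq> N\<close>, regularity is expressed by such inclusions.
\<close>

definition scaled :: "'a \<Rightarrow> 'c set \<Rightarrow> 'c set" where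
  "scaled b K = (\<lambda>x. b \<odot>\<^bsub>M\<^esub> x) ` K"

definition colon :: "'c set \<Rightarrow> 'a \<Rightarrow> 'c set" where
  "colon K b = {x \<in> carrier M. b \<odot>\<^bsub>M\<^esub> x \<in> K}"

lemma submodule_scaled:
  assumes b: "b \<in> carrier R" and K: "submodule K R M"
  shows "submodule (scaled b K) R M"
proof -
  note E = submoduleE[OF K]
  have c: "x \<in> carrier M" if "x \<in> K" for x using E(1) that by auto
  show ?thesis
  proof (rule submoduleI)
    show "\<zero>\<^bsub>M\<^esub> \<in> scaled b K"
      unfolding scaled_def using submodule_has_zero[OF K] b by (metis image_eqI smult_r_null)
    fix r z assume "r \<in> carrier R" "z \<in> scaled b K"
    then obtain x where x: "r \<in> carrier R" "x \<in> K" "z = b \<odot>\<^bsub>M\<^esub> x" by (auto simp: scaled_def)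
    have "r \<odot>\<^bsub>M\<^esub> z = b \<odot>\<^bsub>M\<^esub> (r \<odot>\<^bsub>M\<^esub> x)"
      using x b c by (metis smult_assoc1 R.m_comm)
    then show "r \<odot>\<^bsub>M\<^esub> z \<in> scaled b K" using E(4)[OF x(1,2)] by (auto simp: scaled_def)
  next
    fix z assume "z \<in> scaled b K"
    then obtain x where x: "x \<in> K" "z = b \<odot>\<^bsub>M\<^esub> x" by (auto simp: scaled_def)
    then have "\<ominus>\<^bsub>M\<^esub> z = b \<odot>\<^bsub>M\<^esub> (\<ominus>\<^bsub>M\<^esub> x)" using b c by (simp add: smult_r_minus)
    then show "\<ominus>\<^bsub>M\<^esub> z \<in> scaled b K" using E(3)[OF x(1)] by (auto simp: scaled_def)
  next
    fix z z' assume "z \<in> scaled b K" "z' \<in> scaled b K"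
    then obtain x x' where x: "x \<in> K" "x' \<in> K" "z = b \<odot>\<^bsub>M\<^esub> x" "z' = b \<odot>\<^bsub>M\<^esub> x'"
      by (auto simp: scaled_def)
    then have "z \<oplus>\<^bsub>M\<^esub> z' = b \<odot>\<^bsub>M\<^esub> (x \<oplus>\<^bsub>M\<^esub> x')" using b c by (simp add: smult_r_distr)
    then show "z \<oplus>\<^bsub>M\<^esub> z' \<in> scaled b K" using E(5)[OF x(1,2)] by (auto simp: scaled_def)
  qed (use b c in \<open>auto simp: scaled_def\<close>)
qed

lemma submodule_colon:
  assumes b: "b \<in> carrier R" and K: "submodule K R M"
  shows "submodule (colon K b) R M"
proof -
  note E = submoduleE[OF K]
  show ?thesis
  proof (rule submoduleI)
    fix r x assume x: "r \<in> carrier R" "x \<in> colon K b"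
    then have "b \<odot>\<^bsub>M\<^esub> (r \<odot>\<^bsub>M\<^esub> x) = r \<odot>\<^bsub>M\<^esub> (b \<odot>\<^bsub>M\<^esub> x)"
      using b by (auto simp: colon_def smult_assoc1[symmetric] R.m_comm)
    then show "r \<odot>\<^bsub>M\<^esub> x \<in> colon K b" using x E(4) by (auto simp: colon_def)
  qed (use b E submodule_has_zero[OF K] in \<open>auto simp: colon_def smult_r_minus smult_r_distr\<close>)
qed

lemma colon_mult:
  assumes "b \<in> carrier R" "c \<in> carrier R"
  shows "colon K (b \<otimes> c) = colon (colon K b) c"
  using assms by (auto simp: colon_def smult_assoc1)

lemma scaled_mult:
  assumes "b \<in> carrier R" "c \<in> carrier R" "K \<subseteq> carrier M"
  shows "scaled (b \<otimes> c) K = scaled b (scaled c K)"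
  using assms by (force simp: scaled_def smult_assoc1 image_image intro!: image_cong)

lemma scaled_mono: "K \<subseteq> L \<Longrightarrow> scaled b K \<subseteq> scaled b L"
  by (auto simp: scaled_def)

lemma scaled_subset: "b \<in> carrier R \<Longrightarrow> submodule K R M \<Longrightarrow> scaled b K \<subseteq> K"
  using submoduleE(4) by (auto simp: scaled_def)

lemma scaled_subset_iff:
  assumes "b \<in> carrier R" "K \<subseteq> carrier M" "submodule L R M" "colon {\<zero>\<^bsub>M\<^esub>} b \<subseteq> L"
  shows "scaled b K \<subseteq> scaled b L \<longleftrightarrow> K \<subseteq> L"
proof
  assume le: "scaled b K \<subseteq> scaled b L"
  show "K \<subseteq> L"
  proof
    fix x assume x: "x \<in> K"
    then have "b \<odot>\<^bsub>M\<^esub> x \<in> scaled b L" using le by (auto simp: scaled_def)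
    then obtain y where y: "y \<in> L" "b \<odot>\<^bsub>M\<^esub> x = b \<odot>\<^bsub>M\<^esub> y" by (auto simp: scaled_def)
    have c: "x \<in> carrier M" "y \<in> carrier M" using x y assms(2) submoduleE(1)[OF assms(3)] by auto
    have "b \<odot>\<^bsub>M\<^esub> (x \<ominus>\<^bsub>M\<^esub> y) = \<zero>\<^bsub>M\<^esub>"
      using c y assms(1) by (simp add: a_minus_def smult_r_distr smult_r_minus M.r_neg)
    then have "x \<ominus>\<^bsub>M\<^esub> y \<in> L" using assms(4) c by (auto simp: colon_def)
    then have "(x \<ominus>\<^bsub>M\<^esub> y) \<oplus>\<^bsub>M\<^esub> y \<in> L" using y submoduleE(5)[OF assms(3)] by blast
    then show "x \<in> L" using c by (simp add: a_minus_def M.a_assoc M.l_neg)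
  qed
qed (rule scaled_mono)

text \<open>
  The isomorphism theorem for multiplication by \<open>b\<close>: images and preimages are inverse bijections
  between the submodules that contain the kernel and the submodules of \<open>bM\<close>.
\<close>

lemma interval_length_scaled:
  assumes b: "b \<in> carrier R" and K: "submodule K R M" and ker: "colon {\<zero>\<^bsub>M\<^esub>} b \<subseteq> K"
  shows "interval_length R M (scaled b K) (scaled b (carrier M)) = interval_length R M K (carrier M)"
proof (rule antisym)
  note KM = submoduleE(1)[OF K]
  show "interval_length R M (scaled b K) (scaled b (carrier M)) \<le> interval_length R M K (carrier M)"
    unfolding interval_length_def
  proof (rule chain_length_mono_map[where f = "\<lambda>L. colon L b"])
    fix L assume "L \<in> {L. submodule L R M \<and> scaled b K \<subseteq> L \<and> L \<subseteq> scaled b (carrier M)}"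
    then have L: "submodule L R M" "scaled b K \<subseteq> L" "L \<subseteq> scaled b (carrier M)" by auto
    show "colon L b \<in> {L. submodule L R M \<and> K \<subseteq> L \<and> L \<subseteq> carrier M}"
      using submodule_colon[OF b L(1)] L(2) KM by (auto simp: colon_def scaled_def)
    fix L' assume L': "L' \<in> {L. submodule L R M \<and> scaled b K \<subseteq> L \<and> L \<subseteq> scaled b (carrier M)}" "L \<subset> L'"
    then obtain y where "y \<in> L'" "y \<notin> L" by blast
    then have "y \<in> scaled b (carrier M)" using L'(1) by blast
    then obtain x where "y = b \<odot>\<^bsub>M\<^esub> x" "x \<in> carrier M" by (auto simp: scaled_def)
    with \<open>y \<in> L'\<close> \<open>y \<notin> L\<close> have "x \<in> colon L' b" "x \<notin> colon L b" by (auto simp: colon_def)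
    then show "colon L b \<subset> colon L' b" using L'(2) by (auto simp: colon_def)
  qed
  show "interval_length R M K (carrier M) \<le> interval_length R M (scaled b K) (scaled b (carrier M))"
    unfolding interval_length_def
  proof (rule chain_length_mono_map[where f = "scaled b"])
    fix L assume "L \<in> {L. submodule L R M \<and> K \<subseteq> L \<and> L \<subseteq> carrier M}"
    then have L: "submodule L R M" "K \<subseteq> L" "L \<subseteq> carrier M" by auto
    show "scaled b L \<in> {L. submodule L R M \<and> scaled b K \<subseteq> L \<and> L \<subseteq> scaled b (carrier M)}"
      using submodule_scaled[OF b L(1)] scaled_mono L by auto
    fix L' assume L': "L' \<in> {L. submodule L R M \<and> K \<subseteq> L \<and> L \<subseteq> carrier M}" "L \<subset> L'"
    then have "\<not> scaled b L' \<subseteq> scaled b L"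
      using scaled_subset_iff[OF b _ L(1), of L'] ker L(2) by blast
    then show "scaled b L \<subset> scaled b L'" using scaled_mono[of L L' b] L' by blast
  qed
qed

end


section \<open>Submodules of a quotient module\<close>

context module
begin

lemma mem_a_r_coset_iff:
  assumes N: "submodule N R M" and x: "x \<in> carrier M"
  shows "y \<in> N +>\<^bsub>M\<^esub> x \<longleftrightarrow> y \<in> carrier M \<and> y \<ominus>\<^bsub>M\<^esub> x \<in> N"
proof
  have NM: "N \<subseteq> carrier M" by (rule submoduleE(1)[OF N])
  {
    assume "y \<in> N +>\<^bsub>M\<^esub> x"
    then obtain n where n: "n \<in> N" "y = n \<oplus>\<^bsub>M\<^esub> x" by (auto simp: a_r_coset_def')
    then have "y \<in> carrier M" "y \<ominus>\<^bsub>M\<^esub> x = n"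
      using NM x by (auto simp: a_minus_def M.a_assoc M.r_neg subsetD)
    with n show "y \<in> carrier M \<and> y \<ominus>\<^bsub>M\<^esub> x \<in> N" by simp
  next
    assume y: "y \<in> carrier M \<and> y \<ominus>\<^bsub>M\<^esub> x \<in> N"
    then have "y = (y \<ominus>\<^bsub>M\<^esub> x) \<oplus>\<^bsub>M\<^esub> x" using x by (simp add: a_minus_def M.a_assoc M.l_neg)
    with y show "y \<in> N +>\<^bsub>M\<^esub> x" unfolding a_r_coset_def' by blast
  }
qed

lemma a_r_coset_eq_iff:
  assumes N: "submodule N R M" and x: "x \<in> carrier M" "y \<in> carrier M"
  shows "N +>\<^bsub>M\<^esub> x = N +>\<^bsub>M\<^esub> y \<longleftrightarrow> x \<ominus>\<^bsub>M\<^esub> y \<in> N"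
proof
  assume "N +>\<^bsub>M\<^esub> x = N +>\<^bsub>M\<^esub> y"
  moreover have "x \<in> N +>\<^bsub>M\<^esub> x"
    using x submodule_has_zero[OF N] by (simp add: mem_a_r_coset_iff[OF N] a_minus_def M.r_neg)
  ultimately show "x \<ominus>\<^bsub>M\<^esub> y \<in> N" using mem_a_r_coset_iff[OF N x(2)] by auto
next
  assume d: "x \<ominus>\<^bsub>M\<^esub> y \<in> N"
  interpret A: abelian_subgroup N M
    by (rule submodule_abelian_subgroup[OF module_axioms N])
  have "x \<in> N +>\<^bsub>M\<^esub> y" using d x by (simp add: mem_a_r_coset_iff[OF N])
  then show "N +>\<^bsub>M\<^esub> x = N +>\<^bsub>M\<^esub> y"
    using M.a_repr_independence[OF _ x(2) A.a_subgroup] by simp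
qed

lemma carrier_quotient_module: "carrier (quotient_module M N) = (\<lambda>x. N +>\<^bsub>M\<^esub> x) ` carrier M"
  by (auto simp: quotient_module_def A_RCOSETS_def')

lemma zero_quotient_module:
  assumes N: "submodule N R M"
  shows "\<zero>\<^bsub>quotient_module M N\<^esub> = N +>\<^bsub>M\<^esub> \<zero>\<^bsub>M\<^esub>"
  using submoduleE(1)[OF N] by (simp add: quotient_module_def M.a_coset_add_zero)

lemma coset_eq_zero_iff:
  assumes N: "submodule N R M" and x: "x \<in> carrier M"
  shows "N +>\<^bsub>M\<^esub> x = \<zero>\<^bsub>quotient_module M N\<^esub> \<longleftrightarrow> x \<in> N"
proof -
  have "\<ominus>\<^bsub>M\<^esub> \<zero>\<^bsub>M\<^esub> = \<zero>\<^bsub>M\<^esub>" by (rule M.minus_equality) auto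
  then have "x \<ominus>\<^bsub>M\<^esub> \<zero>\<^bsub>M\<^esub> = x" using x by (simp add: a_minus_def)
  then show ?thesis
    unfolding zero_quotient_module[OF N] a_r_coset_eq_iff[OF N x M.zero_closed] by simp
qed

lemma add_quotient_module:
  assumes "submodule N R M" "x \<in> carrier M" "y \<in> carrier M"
  shows "(N +>\<^bsub>M\<^esub> x) \<oplus>\<^bsub>quotient_module M N\<^esub> (N +>\<^bsub>M\<^esub> y) = N +>\<^bsub>M\<^esub> (x \<oplus>\<^bsub>M\<^esub> y)"
proof -
  interpret A: abelian_subgroup N M
    by (rule submodule_abelian_subgroup[OF module_axioms assms(1)])
  show ?thesis using A.a_rcos_sum[OF assms(2,3)] by (simp add: quotient_module_def)
qed

lemma minus_quotient_module:
  assumes N: "submodule N R M" and x: "x \<in> carrier M"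
  shows "\<ominus>\<^bsub>quotient_module M N\<^esub> (N +>\<^bsub>M\<^esub> x) = N +>\<^bsub>M\<^esub> (\<ominus>\<^bsub>M\<^esub> x)"
proof -
  interpret Q: module R "quotient_module M N"
    by (rule quotient_module_is_module[OF module_axioms N])
  show ?thesis
    by (rule Q.M.minus_equality)
       (use x in \<open>auto simp: add_quotient_module[OF N] zero_quotient_module[OF N]
          carrier_quotient_module M.l_neg\<close>)
qed

lemma submodule_quotient_image:
  assumes N: "submodule N R M" and K: "submodule K R M"
  shows "submodule ((\<lambda>x. N +>\<^bsub>M\<^esub> x) ` K) R (quotient_module M N)"
proof -
  interpret Q: module R "quotient_module M N"
    by (rule quotient_module_is_module[OF module_axioms N])
  note E = submoduleE[OF K]
  have c: "x \<in> carrier M" if "x \<in> K" for x using E(1) that by auto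
  show ?thesis
    by (rule Q.submoduleI)
       (use E submodule_has_zero[OF K] in \<open>auto simp: c carrier_quotient_module
          zero_quotient_module[OF N] minus_quotient_module[OF N] add_quotient_module[OF N]
          quotient_module_smult[OF module_axioms N]\<close>)
qed

lemma submodule_quotient_preimage:
  assumes N: "submodule N R M" and K: "submodule K R (quotient_module M N)"
  shows "submodule {x \<in> carrier M. N +>\<^bsub>M\<^esub> x \<in> K} R M"
proof -
  interpret Q: module R "quotient_module M N"
    by (rule quotient_module_is_module[OF module_axioms N])
  note E = Q.submoduleE[OF K]
  show ?thesis
    by (rule submoduleI)
       (use E Q.submodule_has_zero[OF K] in \<open>auto simp: zero_quotient_module[OF N]
          minus_quotient_module[OF N, symmetric] add_quotient_module[OF N, symmetric]
          quotient_module_smult[OF module_axioms N, symmetric]\<close>)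
qed

text \<open>
  The correspondence between the submodules of \<open>M/N\<close> and the submodules of \<open>M\<close> that contain \<open>N\<close>.
\<close>

lemma module_length_quotient:
  assumes N: "submodule N R M"
  shows "module_length R (quotient_module M N) = interval_length R M N (carrier M)"
proof -
  let ?Q = "quotient_module M N"
  interpret Q: module R ?Q
    by (rule quotient_module_is_module[OF module_axioms N])
  let ?S = "{K. submodule K R ?Q}" and ?T = "{K. submodule K R M \<and> N \<subseteq> K \<and> K \<subseteq> carrier M}"
  note NM = submoduleE(1)[OF N]
  have "module_length R ?Q = chain_length ?S"
    by (simp add: module_length_def chain_length_def)
  also have "\<dots> = chain_length ?T"
  proof (rule antisym)
    show "chain_length ?S \<le> chain_length ?T"
    proof (rule chain_length_mono_map[where f = "\<lambda>K. {x \<in> carrier M. N +>\<^bsub>M\<^esub> x \<in> K}"])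
      fix K assume "K \<in> ?S"
      then have K: "submodule K R ?Q" by simp
      have "N +>\<^bsub>M\<^esub> x \<in> K" if "x \<in> N" for x
        using coset_eq_zero_iff[OF N, of x] that NM Q.submodule_has_zero[OF K] by auto
      then show "{x \<in> carrier M. N +>\<^bsub>M\<^esub> x \<in> K} \<in> ?T"
        using submodule_quotient_preimage[OF N K] NM by auto
      fix L assume "L \<in> ?S" "K \<subset> L"
      then show "{x \<in> carrier M. N +>\<^bsub>M\<^esub> x \<in> K} \<subset> {x \<in> carrier M. N +>\<^bsub>M\<^esub> x \<in> L}"
        using Q.submoduleE(1)[of L] by (auto simp: carrier_quotient_module)
    qed
    show "chain_length ?T \<le> chain_length ?S"
    proof (rule chain_length_mono_map[where f = "\<lambda>K. (\<lambda>x. N +>\<^bsub>M\<^esub> x) ` K"])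
      fix K assume "K \<in> ?T"
      then have K: "submodule K R M" "N \<subseteq> K" by auto
      show "(\<lambda>x. N +>\<^bsub>M\<^esub> x) ` K \<in> ?S" using submodule_quotient_image[OF N K(1)] by simp
      fix L assume L: "L \<in> ?T" "K \<subset> L"
      then obtain x where x: "x \<in> L" "x \<notin> K" "x \<in> carrier M" by auto
      have "N +>\<^bsub>M\<^esub> x \<notin> (\<lambda>x. N +>\<^bsub>M\<^esub> x) ` K"
      proof
        assume "N +>\<^bsub>M\<^esub> x \<in> (\<lambda>x. N +>\<^bsub>M\<^esub> x) ` K"
        then obtain y where y: "y \<in> K" "N +>\<^bsub>M\<^esub> x = N +>\<^bsub>M\<^esub> y" by auto
        have yM: "y \<in> carrier M" using y submoduleE(1)[OF K(1)] by auto
        have "x \<ominus>\<^bsub>M\<^esub> y \<in> K" using a_r_coset_eq_iff[OF N x(3) yM] y K(2) by auto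
        then have "(x \<ominus>\<^bsub>M\<^esub> y) \<oplus>\<^bsub>M\<^esub> y \<in> K" using y submoduleE(5)[OF K(1)] by blast
        then show False using x yM by (simp add: a_minus_def M.a_assoc M.l_neg)
      qed
      then show "(\<lambda>x. N +>\<^bsub>M\<^esub> x) ` K \<subset> (\<lambda>x. N +>\<^bsub>M\<^esub> x) ` L" using x L by blast
    qed
  qed
  finally show ?thesis by (simp add: interval_length_def)
qed

lemma nonzerodivisor_on_quotient_iff:
  assumes N: "submodule N R M" and r: "r \<in> carrier R"
  shows "nonzerodivisor_on R (quotient_module M N) r \<longleftrightarrow> colon N r \<subseteq> N"
  using r by (auto simp: nonzerodivisor_on_def carrier_quotient_module colon_def
      coset_eq_zero_iff[OF N] quotient_module_smult[OF module_axioms N])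

end


section \<open>Spans and principal ideals\<close>

context module
begin

lemma module_span_least: "submodule N R M \<Longrightarrow> S \<subseteq> N \<Longrightarrow> module_span R M S \<subseteq> N"
  by (auto simp: module_span_def)

lemma module_span_superset: "S \<subseteq> module_span R M S"
  by (auto simp: module_span_def)

lemma submodule_module_span:
  assumes "S \<subseteq> carrier M"
  shows "submodule (module_span R M S) R M"
proof (rule submoduleI)
  show "module_span R M S \<subseteq> carrier M"
    by (rule module_span_least[OF carrier_is_submodule assms])
qed (auto simp: module_span_def submodule_has_zero dest: submoduleE(3-5))

lemma submodule_cyclic:
  assumes x: "x \<in> carrier M"
  shows "submodule ((\<lambda>s. s \<odot>\<^bsub>M\<^esub> x) ` carrier R) R M"
proof (rule submoduleI)
  show "\<zero>\<^bsub>M\<^esub> \<in> (\<lambda>s. s \<odot>\<^bsub>M\<^esub> x) ` carrier R"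
    using x by (intro image_eqI[of _ _ \<zero>]) auto
next
  fix y assume "y \<in> (\<lambda>s. s \<odot>\<^bsub>M\<^esub> x) ` carrier R"
  then obtain s where s: "s \<in> carrier R" "y = s \<odot>\<^bsub>M\<^esub> x" by auto
  then show "\<ominus>\<^bsub>M\<^esub> y \<in> (\<lambda>s. s \<odot>\<^bsub>M\<^esub> x) ` carrier R"
    using x by (intro image_eqI[of _ _ "\<ominus> s"]) (auto simp: smult_l_minus)
next
  fix y z assume "y \<in> (\<lambda>s. s \<odot>\<^bsub>M\<^esub> x) ` carrier R" "z \<in> (\<lambda>s. s \<odot>\<^bsub>M\<^esub> x) ` carrier R"
  then obtain s t where s: "s \<in> carrier R" "y = s \<odot>\<^bsub>M\<^esub> x" "t \<in> carrier R" "z = t \<odot>\<^bsub>M\<^esub> x" by auto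
  then show "y \<oplus>\<^bsub>M\<^esub> z \<in> (\<lambda>s. s \<odot>\<^bsub>M\<^esub> x) ` carrier R"
    using x by (intro image_eqI[of _ _ "s \<oplus> t"]) (auto simp: smult_l_distr)
next
  fix r y assume r: "r \<in> carrier R" and "y \<in> (\<lambda>s. s \<odot>\<^bsub>M\<^esub> x) ` carrier R"
  then obtain s where s: "s \<in> carrier R" "y = s \<odot>\<^bsub>M\<^esub> x" by auto
  then show "r \<odot>\<^bsub>M\<^esub> y \<in> (\<lambda>s. s \<odot>\<^bsub>M\<^esub> x) ` carrier R"
    using x r by (intro image_eqI[of _ _ "r \<otimes> s"]) (auto simp: smult_assoc1)
qed (use x in auto)

lemma module_span_insert_subset:
  assumes "x \<in> carrier M" "S \<subseteq> carrier M"
  shows "module_span R M (insert x S) \<subseteq> (\<lambda>s. s \<odot>\<^bsub>M\<^esub> x) ` carrier R <+>\<^bsub>M\<^esub> module_span R M S"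
proof (rule module_span_least)
  note C = submodule_cyclic[OF assms(1)] and S = submodule_module_span[OF assms(2)]
  show "submodule ((\<lambda>s. s \<odot>\<^bsub>M\<^esub> x) ` carrier R <+>\<^bsub>M\<^esub> module_span R M S) R M"
    by (rule submodule_add[OF C S])
  have "x \<in> (\<lambda>s. s \<odot>\<^bsub>M\<^esub> x) ` carrier R"
    using assms(1) by (intro image_eqI[of _ _ \<one>]) auto
  then show "insert x S \<subseteq> (\<lambda>s. s \<odot>\<^bsub>M\<^esub> x) ` carrier R <+>\<^bsub>M\<^esub> module_span R M S"
    using set_add_upper[OF C S] module_span_superset[of S] by blast
qed

lemma ideal_smult_principal:
  assumes b: "b \<in> carrier R"
  shows "ideal_smult R (PIdl b) M = scaled b (carrier M)"
proof
  have "r \<odot>\<^bsub>M\<^esub> x \<in> scaled b (carrier M)" if r: "r \<in> PIdl b" and x: "x \<in> carrier M" for r x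
  proof -
    obtain s where s: "s \<in> carrier R" "r = s \<otimes> b" using r by (auto simp: cgenideal_def)
    then have "r \<odot>\<^bsub>M\<^esub> x = b \<odot>\<^bsub>M\<^esub> (s \<odot>\<^bsub>M\<^esub> x)"
      using b x by (simp add: smult_assoc1[symmetric] R.m_comm)
    then show ?thesis using s x by (auto simp: scaled_def)
  qed
  then show "ideal_smult R (PIdl b) M \<subseteq> scaled b (carrier M)"
    unfolding ideal_smult_def
    by (intro module_span_least submodule_scaled[OF b carrier_is_submodule]) auto
  have "scaled b (carrier M) \<subseteq> {r \<odot>\<^bsub>M\<^esub> x | r x. r \<in> PIdl b \<and> x \<in> carrier M}"
    using R.cgenideal_self[OF b] by (auto simp: scaled_def)
  then show "scaled b (carrier M) \<subseteq> ideal_smult R (PIdl b) M"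
    unfolding ideal_smult_def using module_span_superset by blast
qed

lemma ideal_smult_Idl_empty: "ideal_smult R (Idl {}) M = {\<zero>\<^bsub>M\<^esub>}"
proof -
  have "Idl {} = {\<zero>}"
    using R.genideal_minimal[OF R.zeroideal, of "{}"]
      additive_subgroup.zero_closed[OF ideal.axioms(1)[OF R.genideal_ideal[of "{}"]]] by auto
  also have "\<dots> = PIdl \<zero>" by (auto simp: cgenideal_def intro!: exI[of _ \<zero>])
  finally show ?thesis
    using ideal_smult_principal[OF R.zero_closed] by (force simp: scaled_def)
qed

end

lemma (in cring) cgenideal_pow:
  assumes b: "b \<in> carrier R"
  shows "(PIdl b) [^]\<^bsub>ideals_set R\<^esub> n = PIdl (b [^] (n::nat))"
proof (induction n)
  case 0
  have "PIdl \<one> = carrier R" by (force simp: cgenideal_def)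
  then show ?case by (simp add: ideals_set_def)
next
  case (Suc n)
  have bn: "b [^] n \<in> carrier R" using b by simp
  have "ideal_prod R (PIdl (b [^] n)) (PIdl b) = Idl (PIdl (b [^] n \<otimes> b))"
    using ideal_prod_eq_genideal[OF cgenideal_ideal[OF bn] cgenideal_ideal[OF b]]
    by (simp add: cgenideal_prod[OF bn b])
  also have "\<dots> = PIdl (b [^] n \<otimes> b)"
    using genideal_minimal[OF cgenideal_ideal[of "b [^] n \<otimes> b"] order_refl]
      genideal_self[of "PIdl (b [^] n \<otimes> b)"] additive_subgroup.a_subset[OF ideal.axioms(1)[OF cgenideal_ideal[of "b [^] n \<otimes> b"]]]
      b by auto
  finally show ?case using Suc.IH by (simp add: ideals_set_def)
qed


section \<open>Noetherian modules and the lemma of Nakayama\<close>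

locale noetherian_module = module R M + noetherian_ring R for R (structure) and M (structure) +
  assumes finitely_generated: "finitely_generated_module R M"

lemma (in noetherian_ring) ascending_ideals_stabilize:
  assumes ideal: "\<And>i. ideal (J i) R" and inc: "\<And>i. J i \<subseteq> J (Suc i)"
  shows "\<exists>c. \<forall>i\<ge>c. J i = J c"
proof -
  have mono: "J i \<subseteq> J j" if "i \<le> j" for i j using lift_Suc_mono_le[of J, OF inc that] .
  have "subset.chain {I. ideal I R} (range J)"
    unfolding pred_on.chain_def using ideal mono by (auto; metis nle_le subsetD psubsetI)
  then have "\<Union> (range J) \<in> range J" by (intro ideal_chain_is_trivial) auto
  then obtain c where c: "\<Union> (range J) = J c" by blast
  show ?thesis by (rule exI[of _ c]) (use c mono in blast)
qed

lemma (in noetherian_ring) exists_maximalideal: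
  assumes I: "ideal I R" "I \<noteq> carrier R"
  obtains J where "maximalideal J R" "I \<subseteq> J"
proof -
  let ?A = "{J. ideal J R \<and> I \<subseteq> J \<and> J \<noteq> carrier R}"
  have "\<exists>J\<in>?A. \<forall>X\<in>?A. J \<subseteq> X \<longrightarrow> X = J"
  proof (rule subset_Zorn_nonempty)
    show "?A \<noteq> {}" using I by auto
    fix C assume C: "C \<noteq> {}" "subset.chain ?A C"
    then have "subset.chain {I. ideal I R} C" by (auto simp: pred_on.chain_def)
    with C(1) have "\<Union>C \<in> C" by (rule ideal_chain_is_trivial)
    with C(2) show "\<Union>C \<in> ?A" by (auto simp: pred_on.chain_def)
  qed
  then obtain J where J: "J \<in> ?A" and max: "\<forall>X\<in>?A. J \<subseteq> X \<longrightarrow> X = J" ..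
  have "maximalideal J R"
    by (rule maximalidealI) (use J max in blast)+
  with J show ?thesis using that by blast
qed

context noetherian_module
begin

text \<open>
  Induction on the generators. For the module spanned by \<open>x\<close> and \<open>S\<close>, the part of the chain in
  the span of \<open>S\<close> is stable by induction, and the coefficients at \<open>x\<close> of elements of \<open>N i\<close> are
  controlled by the ideals of those \<open>s\<close> with \<open>s x\<close> in the sum of \<open>N i\<close> and the span of \<open>S\<close>. An
  element of a later \<open>N i\<close> differs from one of \<open>N c\<close> by an element of \<open>N i\<close> in the span of \<open>S\<close>.
\<close>

lemma ascending_on_span_stabilize:
  assumes "finite S" "S \<subseteq> carrier M"
    and sub: "\<And>i::nat. submodule (N i) R M" and inc: "\<And>i. N i \<subseteq> N (Suc i)"
  shows "\<exists>c. \<forall>i\<ge>c. N i \<inter> module_span R M S = N c \<inter> module_span R M S"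
  using assms(1,2)
proof (induction S rule: finite_induct)
  case empty
  have "module_span R M {} = {\<zero>\<^bsub>M\<^esub>}"
    using module_span_least[OF submodule_zero, of "{}"]
      submodule_has_zero[OF submodule_module_span[of "{}"]] by auto
  then show ?case using submodule_has_zero[OF sub] by auto
next
  case (insert x S)
  let ?T = "module_span R M S" and ?U = "module_span R M (insert x S)"
  have x: "x \<in> carrier M" and S: "S \<subseteq> carrier M" using insert by auto
  note T = submodule_module_span[OF S]
  have mono: "N i \<subseteq> N j" if "i \<le> j" for i j using lift_Suc_mono_le[of N, OF inc that] .
  have NM: "N i \<subseteq> carrier M" for i by (rule submoduleE(1)[OF sub])
  have TM: "?T \<subseteq> carrier M" by (rule submoduleE(1)[OF T])
  \<comment> \<open>the ideal of coefficients at \<open>x\<close>\<close>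
  define J where "J = (\<lambda>i. {s \<in> carrier R. s \<odot>\<^bsub>M\<^esub> x \<in> N i <+>\<^bsub>M\<^esub> ?T})"
  have "ideal (J i) R" for i
  proof -
    note NT = submodule_add[OF sub[of i] T]
    let ?J = "\<lambda>i. {s \<in> carrier R. s \<odot>\<^bsub>M\<^esub> x \<in> N i <+>\<^bsub>M\<^esub> ?T}"
    show ?thesis
      unfolding J_def
    proof (rule idealI)
      show "ring R" by (rule R.ring_axioms)
      show "subgroup (?J i) (add_monoid R)"
      proof
        show "inv\<^bsub>add_monoid R\<^esub> y \<in> ?J i" if "y \<in> ?J i" for y
          using that submoduleE(3)[OF NT] x by (simp add: smult_l_minus a_inv_def[symmetric])
      qed (use x submoduleE(5)[OF NT] submodule_has_zero[OF NT] in \<open>auto simp: smult_l_distr\<close>)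
    next
      fix s r assume s: "s \<in> ?J i" and r: "r \<in> carrier R"
      have "(r \<otimes> s) \<odot>\<^bsub>M\<^esub> x \<in> N i <+>\<^bsub>M\<^esub> ?T"
        using s r submoduleE(4)[OF NT r] x by (simp add: smult_assoc1)
      with s r show "r \<otimes> s \<in> ?J i" "s \<otimes> r \<in> ?J i" by (auto simp: R.m_comm)
    qed
  qed
  moreover have "J i \<subseteq> J (Suc i)" for i
    using inc[of i] by (auto simp: J_def elim!: set_add_memE intro!: set_add_memI)
  ultimately have "\<exists>c. \<forall>i\<ge>c. J i = J c" by (rule ascending_ideals_stabilize)
  then obtain c1 where c1: "\<And>i. i \<ge> c1 \<Longrightarrow> J i = J c1" by blast
  from insert S obtain c2 where c2: "\<And>i. i \<ge> c2 \<Longrightarrow> N i \<inter> ?T = N c2 \<inter> ?T" by auto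
  let ?c = "max c1 c2"
  have "N i \<inter> ?U \<subseteq> N ?c" if i: "i \<ge> ?c" for i
  proof
    fix y assume y: "y \<in> N i \<inter> ?U"
    then obtain s t where s: "s \<in> carrier R" and t: "t \<in> ?T" and y_eq: "y = s \<odot>\<^bsub>M\<^esub> x \<oplus>\<^bsub>M\<^esub> t"
      using module_span_insert_subset[OF x S] by (auto elim!: set_add_memE)
    have c: "y \<in> carrier M" "t \<in> carrier M" "s \<odot>\<^bsub>M\<^esub> x \<in> carrier M" using y t s x NM TM by auto
    have "s \<odot>\<^bsub>M\<^esub> x = y \<oplus>\<^bsub>M\<^esub> \<ominus>\<^bsub>M\<^esub> t" using c y_eq by (simp add: M.a_assoc M.r_neg)
    then have "s \<in> J i" using y s t submoduleE(3)[OF T] by (auto simp: J_def intro: set_add_memI)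
    then have "s \<in> J ?c" using c1[of i] c1[of ?c] i by auto
    then obtain n t' where n: "n \<in> N ?c" and t': "t' \<in> ?T" and sx: "s \<odot>\<^bsub>M\<^esub> x = n \<oplus>\<^bsub>M\<^esub> t'"
      by (auto simp: J_def elim: set_add_memE)
    have nc: "n \<in> carrier M" "t' \<in> carrier M" using n t' NM TM by auto
    have "y = n \<oplus>\<^bsub>M\<^esub> (t' \<oplus>\<^bsub>M\<^esub> t)" using y_eq sx nc c by (simp add: M.a_assoc)
    then have "y \<ominus>\<^bsub>M\<^esub> n = t' \<oplus>\<^bsub>M\<^esub> t" using nc c by (simp add: add_minus_cancel_left)
    moreover have "y \<ominus>\<^bsub>M\<^esub> n \<in> N i" using submodule_diff[OF sub] y n mono[OF i] by blast
    moreover have "t' \<oplus>\<^bsub>M\<^esub> t \<in> ?T" using submoduleE(5)[OF T] t t' by blast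
    ultimately have "t' \<oplus>\<^bsub>M\<^esub> t \<in> N i \<inter> ?T" by simp
    then have "t' \<oplus>\<^bsub>M\<^esub> t \<in> N ?c" using c2[of i] c2[of ?c] i by auto
    with n \<open>y = n \<oplus>\<^bsub>M\<^esub> (t' \<oplus>\<^bsub>M\<^esub> t)\<close> show "y \<in> N ?c" using submoduleE(5)[OF sub] by blast
  qed
  then have "\<forall>i\<ge>?c. N i \<inter> ?U = N ?c \<inter> ?U" using mono by blast
  then show ?case by blast
qed

lemma ascending_stabilize:
  assumes "\<And>i::nat. submodule (N i) R M" "\<And>i. N i \<subseteq> N (Suc i)"
  shows "\<exists>c. \<forall>i\<ge>c. N i = N c"
proof -
  obtain S where S: "finite S" "S \<subseteq> carrier M" "module_span R M S = carrier M"
    using finitely_generated by (auto simp: finitely_generated_module_def)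
  obtain c where "\<forall>i\<ge>c. N i \<inter> carrier M = N c \<inter> carrier M"
    using ascending_on_span_stabilize[of S N] S assms by metis
  then show ?thesis using submoduleE(1)[OF assms(1)] by (metis inf.absorb1)
qed

lemma exists_maximal_submodule:
  assumes "A \<noteq> {}" and sub: "\<And>K. K \<in> A \<Longrightarrow> submodule K R M"
  obtains N where "N \<in> A" "\<And>K. K \<in> A \<Longrightarrow> \<not> N \<subset> K"
proof -
  have "wf {(K', K). K \<in> A \<and> K' \<in> A \<and> K \<subset> K'}"
    unfolding wf_iff_no_infinite_down_chain
  proof (rule notI, elim exE)
    fix f :: "nat \<Rightarrow> 'c set"
    assume f: "\<forall>i. (f (Suc i), f i) \<in> {(K', K). K \<in> A \<and> K' \<in> A \<and> K \<subset> K'}"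
    have "\<exists>c. \<forall>i\<ge>c. f i = f c" by (rule ascending_stabilize) (use f sub in auto)
    then obtain c where "f (Suc c) = f c" by (meson le_SucI order_refl)
    with f show False by (auto dest!: spec[of _ c])
  qed
  with assms(1) have "\<exists>N\<in>A. \<forall>K. (K, N) \<in> {(K', K). K \<in> A \<and> K' \<in> A \<and> K \<subset> K'} \<longrightarrow> K \<notin> A"
    unfolding wf_eq_minimal by blast
  then show ?thesis using that by blast
qed

end

text \<open>
  If \<open>1 - r\<close> were not a unit, it would lie in a maximal ideal, hence in \<open>\<mm>\<close>, and so would 1.
\<close>

lemma (in noetherian_local_ring) one_minus_Unit:
  assumes "r \<in> \<mm>"
  shows "\<one> \<ominus> r \<in> Units R"
proof (rule ccontr)
  let ?u = "\<one> \<ominus> r"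
  assume nu: "?u \<notin> Units R"
  have r: "r \<in> carrier R" using assms max.a_subset by auto
  have u: "?u \<in> carrier R" using r by simp
  have "\<one> \<notin> PIdl ?u"
  proof
    assume "\<one> \<in> PIdl ?u"
    then obtain s where "s \<in> carrier R" "\<one> = s \<otimes> ?u" by (auto simp: cgenideal_def)
    then have "?u \<in> Units R" using u unfolding Units_def by (auto simp: m_comm intro!: bexI[of _ s])
    with nu show False ..
  qed
  then have "PIdl ?u \<noteq> carrier R" by auto
  then obtain J where J: "maximalideal J R" "PIdl ?u \<subseteq> J"
    using exists_maximalideal[OF cgenideal_ideal[OF u]] by blast
  then have "?u \<in> \<mm>" using cgenideal_self[OF u] maximalideal_unique by blast
  then have "?u \<oplus> r \<in> \<mm>" using assms by (rule max.a_closed)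
  then have "\<one> \<in> \<mm>" using r by (simp add: a_minus_def a_assoc l_neg)
  then have "\<mm> = carrier R" by (rule max.one_imp_carrier)
  then show False using max.I_notcarr by simp
qed

locale noetherian_local_module = noetherian_module R M + noetherian_local_ring \<mm> R
  for \<mm> and R (structure) and M (structure)
begin

lemma maxideal_carrier: "r \<in> \<mm> \<Longrightarrow> r \<in> carrier R"
  using max.a_subset by auto

text \<open>
  A form of Nakayama's lemma for one ring element, proved from the ascending chain condition.
  Among the submodules that contain \<open>N\<close> but not \<open>L\<close> take a maximal one, \<open>K\<close>, and \<open>x \<in> L\<close> outside
  \<open>K\<close>. By maximality \<open>L \<subseteq> K + Rx\<close>, so the hypothesis gives \<open>x \<in> r s x + K\<close> for some \<open>s\<close>. As \<open>1 -
  r s\<close> is a unit, \<open>x\<close> lies in \<open>K\<close>, a contradiction.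
\<close>

lemma nakayama:
  assumes r: "r \<in> \<mm>" and L: "submodule L R M" and N: "submodule N R M"
    and le: "L \<subseteq> scaled r L <+>\<^bsub>M\<^esub> N"
  shows "L \<subseteq> N"
proof (rule ccontr)
  assume "\<not> L \<subseteq> N"
  then have ne: "{K. submodule K R M \<and> N \<subseteq> K \<and> \<not> L \<subseteq> K} \<noteq> {}" (is "?A \<noteq> {}")
    using N by blast
  obtain K where "K \<in> ?A" and maxK: "\<And>K'. K' \<in> ?A \<Longrightarrow> \<not> K \<subset> K'"
    using exists_maximal_submodule[OF ne] by blast
  then have K: "submodule K R M" "N \<subseteq> K" "\<not> L \<subseteq> K" by auto
  have max: "L \<subseteq> K'" if "submodule K' R M" "K \<subset> K'" for K'
    using maxK[of K'] that K(2) by blast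
  from K(3) obtain x where x: "x \<in> L" "x \<notin> K" by blast
  have xM: "x \<in> carrier M" using x submoduleE(1)[OF L] by auto
  have rR: "r \<in> carrier R" by (rule maxideal_carrier[OF r])
  let ?C = "(\<lambda>s. s \<odot>\<^bsub>M\<^esub> x) ` carrier R"
  note C = submodule_cyclic[OF xM]
  have "x \<in> ?C" using xM by (intro image_eqI[of _ _ \<one>]) auto
  then have "K \<subset> K <+>\<^bsub>M\<^esub> ?C" using set_add_upper[OF K(1) C] x by blast
  then have "L \<subseteq> K <+>\<^bsub>M\<^esub> ?C" by (rule max[OF submodule_add[OF K(1) C]])
  moreover obtain l n where l: "l \<in> L" and n: "n \<in> N" and x_eq: "x = r \<odot>\<^bsub>M\<^esub> l \<oplus>\<^bsub>M\<^esub> n"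
    using le x by (auto simp: scaled_def elim!: set_add_memE)
  ultimately obtain k s where k: "k \<in> K" and s: "s \<in> carrier R" and l_eq: "l = k \<oplus>\<^bsub>M\<^esub> s \<odot>\<^bsub>M\<^esub> x"
    by (auto elim!: set_add_memE)
  have c: "k \<in> carrier M" "n \<in> carrier M"
    using k n submoduleE(1)[OF K(1)] submoduleE(1)[OF N] by auto
  let ?u = "\<one> \<ominus> r \<otimes> s"
  have rs: "r \<otimes> s \<in> \<mm>" using r s by (rule max.I_r_closed)
  have u: "?u \<in> Units R" by (rule one_minus_Unit[OF rs])
  have uR: "?u \<in> carrier R" using rR s by simp
  have "x = (r \<otimes> s) \<odot>\<^bsub>M\<^esub> x \<oplus>\<^bsub>M\<^esub> (r \<odot>\<^bsub>M\<^esub> k \<oplus>\<^bsub>M\<^esub> n)"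
    by (subst x_eq, subst l_eq) (use c xM s rR in \<open>simp add: smult_r_distr smult_assoc1 M.a_ac\<close>)
  then have "x \<ominus>\<^bsub>M\<^esub> (r \<otimes> s) \<odot>\<^bsub>M\<^esub> x = r \<odot>\<^bsub>M\<^esub> k \<oplus>\<^bsub>M\<^esub> n"
    using add_minus_cancel_left[of "(r \<otimes> s) \<odot>\<^bsub>M\<^esub> x" "r \<odot>\<^bsub>M\<^esub> k \<oplus>\<^bsub>M\<^esub> n"] c xM s rR by simp
  moreover have "?u \<odot>\<^bsub>M\<^esub> x = x \<ominus>\<^bsub>M\<^esub> (r \<otimes> s) \<odot>\<^bsub>M\<^esub> x"
    using rR s xM by (simp add: a_minus_def smult_l_distr smult_l_minus)
  ultimately have "?u \<odot>\<^bsub>M\<^esub> x = r \<odot>\<^bsub>M\<^esub> k \<oplus>\<^bsub>M\<^esub> n" by simp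
  also have "\<dots> \<in> K" using k n K(2) submoduleE(4,5)[OF K(1)] rR by blast
  finally have "inv ?u \<odot>\<^bsub>M\<^esub> (?u \<odot>\<^bsub>M\<^esub> x) \<in> K"
    using u submoduleE(4)[OF K(1)] by (simp add: R.Units_inv_closed)
  then have "x \<in> K" using u uR xM by (simp add: smult_assoc1[symmetric] R.Units_inv_closed R.Units_l_inv)
  with x show False by simp
qed

text \<open>
  The chain of submodules \<open>b\<^sup>iM + aM\<close> cannot descend strictly for ever, because \<open>M/aM\<close> has
  finite length. Where two consecutive members agree, Nakayama's lemma applies.
\<close>

lemma power_scaled_subset:
  assumes a: "a \<in> carrier R" and b: "b \<in> \<mm>"
    and fin: "interval_length R M (scaled a (carrier M)) (carrier M) < \<infinity>"
  obtains i :: nat where "scaled (b [^] i) (carrier M) \<subseteq> scaled a (carrier M)"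
proof -
  have bR: "b \<in> carrier R" by (rule maxideal_carrier[OF b])
  let ?A = "scaled a (carrier M)"
  let ?B = "\<lambda>i::nat. scaled (b [^] i) (carrier M)"
  let ?N = "\<lambda>i. ?B i <+>\<^bsub>M\<^esub> ?A"
  have A: "submodule ?A R M" by (rule submodule_scaled[OF a carrier_is_submodule])
  have B: "submodule (?B i) R M" for i using bR by (intro submodule_scaled carrier_is_submodule) simp
  have N: "submodule (?N i) R M" for i by (rule submodule_add[OF B A])
  have BS: "?B (Suc i) = scaled b (?B i)" for i
    using bR scaled_mult[of b "b [^] i" "carrier M"] by (simp add: R.m_comm)
  have dec: "?N (Suc i) \<subseteq> ?N i" for i
    unfolding BS using scaled_subset[OF bR B[of i]] by (auto elim!: set_add_memE intro: set_add_memI)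
  have "\<exists>i. ?N (Suc i) = ?N i"
  proof (rule ccontr)
    assume "\<nexists>i. ?N (Suc i) = ?N i"
    then have strict: "?N (Suc i) \<subset> ?N i" for i using dec by blast
    \<comment> \<open>the first \<open>n + 1\<close> members in reverse order form an ascending chain of length \<open>n\<close>\<close>
    have "enat n \<le> interval_length R M ?A (carrier M)" for n
      unfolding enat_le_interval_length_iff[OF A submoduleE(1)[OF A]]
    proof (intro exI[of _ "\<lambda>j. ?N (n - j)"] conjI allI impI)
      show "?N (n - j) \<subset> ?N (n - Suc j)" if "j < n" for j
        using strict[of "n - Suc j"] that by (simp add: Suc_diff_Suc)
    qed (use N submoduleE(1)[OF N] set_add_upper(2)[OF B A] in auto)
    then show False using fin by (metis enat_ord_code(4) linorder_not_less not_enat_eq not_less_iff_gr_or_eq enat_ord_simps(1) lessI)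
  qed
  then obtain i where "?N (Suc i) = ?N i" ..
  then have "?B i \<subseteq> scaled b (?B i) <+>\<^bsub>M\<^esub> ?A" using set_add_upper(1)[OF B A, of i] BS by auto
  from nakayama[OF b B A this] show ?thesis by (rule that)
qed

end


section \<open>Nonzerodivisors and depth\<close>

context module
begin

lemma colon_zero_cancel:
  assumes b: "b \<in> carrier R" and inj: "colon {\<zero>\<^bsub>M\<^esub>} b \<subseteq> {\<zero>\<^bsub>M\<^esub>}"
    and x: "x \<in> carrier M" and y: "y \<in> carrier M" and eq: "b \<odot>\<^bsub>M\<^esub> x = b \<odot>\<^bsub>M\<^esub> y"
  shows "x = y"
proof -
  have "b \<odot>\<^bsub>M\<^esub> (x \<ominus>\<^bsub>M\<^esub> y) = \<zero>\<^bsub>M\<^esub>"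
    using b x y eq by (simp add: a_minus_def smult_r_distr smult_r_minus M.r_neg)
  then have "x \<ominus>\<^bsub>M\<^esub> y = \<zero>\<^bsub>M\<^esub>" using inj x y by (auto simp: colon_def)
  then have "(x \<ominus>\<^bsub>M\<^esub> y) \<oplus>\<^bsub>M\<^esub> y = \<zero>\<^bsub>M\<^esub> \<oplus>\<^bsub>M\<^esub> y" by simp
  then show ?thesis using x y by (simp add: a_minus_def M.a_assoc M.l_neg)
qed

lemma colon_pow_subset:
  assumes b: "b \<in> carrier R" and le: "colon N b \<subseteq> N" and N: "N \<subseteq> carrier M"
  shows "colon N (b [^] (i::nat)) \<subseteq> N"
proof (induction i)
  case 0
  then show ?case by (auto simp: colon_def)
next
  case (Suc i)
  have "colon N (b [^] Suc i) = colon (colon N (b [^] i)) b"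
    using b by (simp add: colon_mult)
  also have "\<dots> \<subseteq> colon N b" using Suc by (auto simp: colon_def)
  finally show ?case using le by blast
qed

lemma scaled_pow_Suc:
  assumes "b \<in> carrier R" "K \<subseteq> carrier M"
  shows "scaled (b [^] Suc i) K = scaled b (scaled (b [^] i) K)"
  using scaled_mult[of b "b [^] i" K] assms by (simp add: R.m_comm)

lemma submodule_scaled_pow:
  "b \<in> carrier R \<Longrightarrow> submodule (scaled (b [^] (i::nat)) (carrier M)) R M"
  by (intro submodule_scaled carrier_is_submodule) simp

text \<open>
  If \<open>b, t\<close> is a regular sequence, so is \<open>b\<^sup>i, t\<close>: when \<open>t f\<close> is divisible by \<open>b\<^sup>i\<^sup>+\<^sup>1\<close>, then \<open>f
  = b f'\<close>, and cancelling \<open>b\<close> shows that \<open>t f'\<close> is divisible by \<open>b\<^sup>i\<close>.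
\<close>

lemma colon_scaled_pow_subset:
  assumes b: "b \<in> carrier R" and t: "t \<in> carrier R"
    and inj: "colon {\<zero>\<^bsub>M\<^esub>} b \<subseteq> {\<zero>\<^bsub>M\<^esub>}"
    and le: "colon (scaled b (carrier M)) t \<subseteq> scaled b (carrier M)"
  shows "colon (scaled (b [^] (i::nat)) (carrier M)) t \<subseteq> scaled (b [^] i) (carrier M)"
proof (induction i)
  case 0
  have "scaled \<one> (carrier M) = carrier M" by (force simp: scaled_def)
  then show ?case by (auto simp: colon_def)
next
  case (Suc i)
  let ?B = "scaled (b [^] i) (carrier M)"
  have B: "?B \<subseteq> carrier M" by (rule submoduleE(1)[OF submodule_scaled_pow[OF b]])
  have S: "scaled (b [^] Suc i) (carrier M) = scaled b ?B" by (rule scaled_pow_Suc[OF b order_refl])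
  show ?case
    unfolding S
  proof
    fix f assume "f \<in> colon (scaled b ?B) t"
    then obtain g where f: "f \<in> carrier M" and g: "g \<in> ?B" and tf: "t \<odot>\<^bsub>M\<^esub> f = b \<odot>\<^bsub>M\<^esub> g"
      by (auto simp: colon_def scaled_def)
    have gM: "g \<in> carrier M" using g B by blast
    have "f \<in> colon (scaled b (carrier M)) t" using f tf gM by (auto simp: colon_def scaled_def)
    then obtain f' where f': "f' \<in> carrier M" "f = b \<odot>\<^bsub>M\<^esub> f'" using le by (auto simp: scaled_def)
    have "b \<odot>\<^bsub>M\<^esub> (t \<odot>\<^bsub>M\<^esub> f') = b \<odot>\<^bsub>M\<^esub> g"
      using tf f' b t by (simp add: smult_assoc1[symmetric] R.m_comm)
    then have "t \<odot>\<^bsub>M\<^esub> f' = g" using colon_zero_cancel[OF b inj] f' t gM by blast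
    then have "f' \<in> colon ?B t" using g f' by (auto simp: colon_def)
    then have "f' \<in> ?B" using Suc by blast
    then show "f \<in> scaled b ?B" using f'(2) by (auto simp: scaled_def)
  qed
qed

lemma colon_pow_mono:
  assumes "b \<in> carrier R"
  shows "colon {\<zero>\<^bsub>M\<^esub>} (b [^] (i::nat)) \<subseteq> colon {\<zero>\<^bsub>M\<^esub>} (b [^] Suc i)"
  using assms smult_assoc1[of b "b [^] i"] by (auto simp: colon_def R.m_comm)

end

context noetherian_local_module
begin

text \<open>
  The stable index is taken positive so that the kernel of \<open>a\<close> itself lies in the stable kernel.
\<close>

lemma torsion_stabilizes:
  assumes a: "a \<in> carrier R"
  obtains c :: nat where "c > 0" "\<And>i. i \<ge> c \<Longrightarrow> colon {\<zero>\<^bsub>M\<^esub>} (a [^] i) = colon {\<zero>\<^bsub>M\<^esub>} (a [^] c)"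
proof -
  have "\<exists>c::nat. \<forall>i\<ge>c. colon {\<zero>\<^bsub>M\<^esub>} (a [^] i) = colon {\<zero>\<^bsub>M\<^esub>} (a [^] c)"
    by (rule ascending_stabilize[where N = "\<lambda>i. colon {\<zero>\<^bsub>M\<^esub>} (a [^] i)"])
       (use a colon_pow_mono in \<open>auto intro: submodule_colon submodule_zero\<close>)
  then obtain c :: nat where c: "\<And>i. i \<ge> c \<Longrightarrow> colon {\<zero>\<^bsub>M\<^esub>} (a [^] i) = colon {\<zero>\<^bsub>M\<^esub>} (a [^] c)"
    by blast
  show ?thesis
  proof (rule that[of "Suc c"])
    fix i assume "i \<ge> Suc c"
    then have "c \<le> i" by simp
    then show "colon {\<zero>\<^bsub>M\<^esub>} (a [^] i) = colon {\<zero>\<^bsub>M\<^esub>} (a [^] Suc c)"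
      using c[of i] c[of "Suc c"] by simp
  qed simp
qed

lemma nakayama_zero:
  assumes r: "r \<in> \<mm>" and L: "submodule L R M" and le: "L \<subseteq> scaled r L"
  shows "L \<subseteq> {\<zero>\<^bsub>M\<^esub>}"
proof (rule nakayama[OF r L submodule_zero])
  have "scaled r L \<subseteq> scaled r L <+>\<^bsub>M\<^esub> {\<zero>\<^bsub>M\<^esub>}"
    by (rule set_add_upper(1)[OF submodule_scaled[OF maxideal_carrier[OF r] L] submodule_zero])
  with le show "L \<subseteq> scaled r L <+>\<^bsub>M\<^esub> {\<zero>\<^bsub>M\<^esub>}" by blast
qed

text \<open>
  Write \<open>W\<close> for the stable kernel. If \<open>w = a y\<close> lies in \<open>W\<close>, then \<open>y\<close> is killed by \<open>a\<^sup>c\<^sup>+\<^sup>1\<close>, so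
  \<open>y \<in> W\<close>. Hence \<open>W = aW\<close>.
\<close>

lemma torsion_in_multiples_zero:
  assumes a: "a \<in> \<mm>"
    and stable: "colon {\<zero>\<^bsub>M\<^esub>} (a [^] Suc c) = colon {\<zero>\<^bsub>M\<^esub>} (a [^] c)"
    and le: "colon {\<zero>\<^bsub>M\<^esub>} (a [^] c) \<subseteq> scaled a (carrier M)"
  shows "colon {\<zero>\<^bsub>M\<^esub>} (a [^] c) \<subseteq> {\<zero>\<^bsub>M\<^esub>}"
proof (rule nakayama_zero[OF a])
  have aR: "a \<in> carrier R" by (rule maxideal_carrier[OF a])
  show "submodule (colon {\<zero>\<^bsub>M\<^esub>} (a [^] c)) R M"
    using aR by (intro submodule_colon submodule_zero) simp
  show "colon {\<zero>\<^bsub>M\<^esub>} (a [^] c) \<subseteq> scaled a (colon {\<zero>\<^bsub>M\<^esub>} (a [^] c))"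
  proof
    fix w assume w: "w \<in> colon {\<zero>\<^bsub>M\<^esub>} (a [^] c)"
    then obtain y where y: "y \<in> carrier M" "w = a \<odot>\<^bsub>M\<^esub> y" using le by (auto simp: scaled_def)
    then have "y \<in> colon {\<zero>\<^bsub>M\<^esub>} (a [^] Suc c)"
      using w aR by (auto simp: colon_def smult_assoc1)
    then show "w \<in> scaled a (colon {\<zero>\<^bsub>M\<^esub>} (a [^] c))" using y(2) stable by (auto simp: scaled_def)
  qed
qed

text \<open>
  Take a power \<open>s\<close> of \<open>b\<close> with \<open>sM \<subseteq> aM\<close>; then \<open>s\<^sup>cM \<subseteq> a\<^sup>cM\<close> for all \<open>c\<close>. If \<open>a x = 0\<close>, write
  \<open>s\<^sup>c x = a\<^sup>c y\<close>. Then \<open>a\<^sup>c\<^sup>+\<^sup>1 y = 0\<close>, and for \<open>c\<close> at which the kernels of the powers of \<open>a\<close>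
  are stable this gives \<open>a\<^sup>c y = 0\<close>. So \<open>s\<^sup>c x = 0\<close> and \<open>x = 0\<close>.
\<close>

lemma nonzerodivisor_parameter:
  assumes a: "a \<in> carrier R" and fin: "interval_length R M (scaled a (carrier M)) (carrier M) < \<infinity>"
    and b: "b \<in> \<mm>" and inj: "colon {\<zero>\<^bsub>M\<^esub>} b \<subseteq> {\<zero>\<^bsub>M\<^esub>}"
  shows "colon {\<zero>\<^bsub>M\<^esub>} a \<subseteq> {\<zero>\<^bsub>M\<^esub>}"
proof
  have bR: "b \<in> carrier R" by (rule maxideal_carrier[OF b])
  obtain i :: nat where i: "scaled (b [^] i) (carrier M) \<subseteq> scaled a (carrier M)"
    by (rule power_scaled_subset[OF a b fin])
  define s where "s = b [^] i"
  have s: "s \<in> carrier R" using bR by (simp add: s_def)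
  have s_inj: "colon {\<zero>\<^bsub>M\<^esub>} (s [^] n) \<subseteq> {\<zero>\<^bsub>M\<^esub>}" for n :: nat
    using colon_pow_subset[OF s colon_pow_subset[OF bR inj, of i, folded s_def]] by simp
  have le: "scaled (s [^] n) (carrier M) \<subseteq> scaled (a [^] n) (carrier M)" for n :: nat
  proof (induction n)
    case (Suc n)
    have "scaled (s [^] Suc n) (carrier M) = scaled (s [^] n) (scaled s (carrier M))"
      using s scaled_mult[of "s [^] n" s "carrier M"] by simp
    also have "\<dots> \<subseteq> scaled (s [^] n) (scaled a (carrier M))"
      using i scaled_mono unfolding s_def by blast
    also have "\<dots> = scaled a (scaled (s [^] n) (carrier M))"
      using s a scaled_mult[of "s [^] n" a "carrier M"] scaled_mult[of a "s [^] n" "carrier M"]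
      by (simp add: R.m_comm)
    also have "\<dots> \<subseteq> scaled a (scaled (a [^] n) (carrier M))" by (rule scaled_mono[OF Suc])
    also have "\<dots> = scaled (a [^] Suc n) (carrier M)" by (rule scaled_pow_Suc[OF a order_refl, symmetric])
    finally show ?case .
  qed simp
  obtain c :: nat where c: "\<And>i. i \<ge> c \<Longrightarrow> colon {\<zero>\<^bsub>M\<^esub>} (a [^] i) = colon {\<zero>\<^bsub>M\<^esub>} (a [^] c)"
    using torsion_stabilizes[OF a] by metis
  fix x assume "x \<in> colon {\<zero>\<^bsub>M\<^esub>} a"
  then have x: "x \<in> carrier M" "a \<odot>\<^bsub>M\<^esub> x = \<zero>\<^bsub>M\<^esub>" by (auto simp: colon_def)
  have "(s [^] c) \<odot>\<^bsub>M\<^esub> x \<in> scaled (a [^] c) (carrier M)"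
    using le[of c] x by (auto simp: scaled_def)
  then obtain y where y: "y \<in> carrier M" "(s [^] c) \<odot>\<^bsub>M\<^esub> x = (a [^] c) \<odot>\<^bsub>M\<^esub> y"
    by (auto simp: scaled_def)
  have "(a [^] Suc c) \<odot>\<^bsub>M\<^esub> y = a \<odot>\<^bsub>M\<^esub> ((s [^] c) \<odot>\<^bsub>M\<^esub> x)"
    using y a by (simp add: smult_assoc1[symmetric] R.m_comm)
  also have "\<dots> = (s [^] c) \<odot>\<^bsub>M\<^esub> (a \<odot>\<^bsub>M\<^esub> x)"
    using a s x(1) by (simp add: smult_assoc1[symmetric] R.m_comm)
  also have "\<dots> = \<zero>\<^bsub>M\<^esub>" using s x by simp
  finally have "y \<in> colon {\<zero>\<^bsub>M\<^esub>} (a [^] c)" using c[of "Suc c"] y(1) by (auto simp: colon_def)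
  then have "x \<in> colon {\<zero>\<^bsub>M\<^esub>} (s [^] c)" using y(2) x by (auto simp: colon_def)
  then show "x \<in> {\<zero>\<^bsub>M\<^esub>}" using s_inj by blast
qed

text \<open>
  Depth is at most 1 when one element \<open>a\<close> is enough to cut \<open>M\<close> down to finite length. After
  passing to powers \<open>s, t\<close> of the regular sequence, \<open>s x = a f\<close> and \<open>t x = a g\<close> for every \<open>x\<close>.
  From \<open>t s x = s t x\<close> one obtains \<open>t f = s g\<close>, since \<open>a\<close> is a nonzerodivisor, and \<open>f = s h\<close> by
  regularity of \<open>s, t\<close>. Then \<open>s x = a s h\<close>, so \<open>x = a h\<close>, and \<open>M = aM\<close>.
\<close>

lemma no_regular_pair:
  assumes a: "a \<in> \<mm>" and fin: "interval_length R M (scaled a (carrier M)) (carrier M) < \<infinity>"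
    and b: "b \<in> \<mm>" "colon {\<zero>\<^bsub>M\<^esub>} b \<subseteq> {\<zero>\<^bsub>M\<^esub>}"
    and r: "r \<in> \<mm>" "colon (scaled b (carrier M)) r \<subseteq> scaled b (carrier M)"
  shows "carrier M = {\<zero>\<^bsub>M\<^esub>}"
proof -
  have aR: "a \<in> carrier R" and bR: "b \<in> carrier R" and rR: "r \<in> carrier R"
    using maxideal_carrier a b r by auto
  obtain i :: nat where i: "scaled (b [^] i) (carrier M) \<subseteq> scaled a (carrier M)"
    by (rule power_scaled_subset[OF aR b(1) fin])
  obtain j :: nat where j: "scaled (r [^] j) (carrier M) \<subseteq> scaled a (carrier M)"
    by (rule power_scaled_subset[OF aR r(1) fin])
  define s t where "s = b [^] i" and "t = r [^] j"
  have s: "s \<in> carrier R" and t: "t \<in> carrier R" using bR rR by (simp_all add: s_def t_def)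
  have a_inj: "colon {\<zero>\<^bsub>M\<^esub>} a \<subseteq> {\<zero>\<^bsub>M\<^esub>}" by (rule nonzerodivisor_parameter[OF aR fin b])
  have s_inj: "colon {\<zero>\<^bsub>M\<^esub>} s \<subseteq> {\<zero>\<^bsub>M\<^esub>}"
    unfolding s_def by (rule colon_pow_subset[OF bR b(2)]) simp
  have "colon (scaled b (carrier M)) t \<subseteq> scaled b (carrier M)"
    unfolding t_def
    by (rule colon_pow_subset[OF rR r(2) submoduleE(1)[OF submodule_scaled[OF bR carrier_is_submodule]]])
  then have t_inj: "colon (scaled s (carrier M)) t \<subseteq> scaled s (carrier M)"
    unfolding s_def by (rule colon_scaled_pow_subset[OF bR t b(2)])
  have "carrier M \<subseteq> scaled a (carrier M)"
  proof
    fix x assume x: "x \<in> carrier M"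
    have "s \<odot>\<^bsub>M\<^esub> x \<in> scaled a (carrier M)" "t \<odot>\<^bsub>M\<^esub> x \<in> scaled a (carrier M)"
      using i j x unfolding s_def t_def by (auto simp: scaled_def)
    then obtain f g where f: "f \<in> carrier M" "s \<odot>\<^bsub>M\<^esub> x = a \<odot>\<^bsub>M\<^esub> f"
      and g: "g \<in> carrier M" "t \<odot>\<^bsub>M\<^esub> x = a \<odot>\<^bsub>M\<^esub> g" by (auto simp: scaled_def)
    have "a \<odot>\<^bsub>M\<^esub> (t \<odot>\<^bsub>M\<^esub> f) = t \<odot>\<^bsub>M\<^esub> (a \<odot>\<^bsub>M\<^esub> f)"
      using aR t f(1) by (simp add: smult_assoc1[symmetric] R.m_comm)
    also have "\<dots> = s \<odot>\<^bsub>M\<^esub> (t \<odot>\<^bsub>M\<^esub> x)"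
      unfolding f(2)[symmetric] using s t x by (simp add: smult_assoc1[symmetric] R.m_comm)
    also have "\<dots> = a \<odot>\<^bsub>M\<^esub> (s \<odot>\<^bsub>M\<^esub> g)"
      unfolding g(2) using aR s g(1) by (simp add: smult_assoc1[symmetric] R.m_comm)
    finally have "t \<odot>\<^bsub>M\<^esub> f = s \<odot>\<^bsub>M\<^esub> g"
      using colon_zero_cancel[OF aR a_inj] s t f(1) g(1) by blast
    then have "f \<in> colon (scaled s (carrier M)) t" using f(1) g(1) by (auto simp: colon_def scaled_def)
    then obtain h where h: "h \<in> carrier M" "f = s \<odot>\<^bsub>M\<^esub> h" using t_inj by (auto simp: scaled_def)
    have "s \<odot>\<^bsub>M\<^esub> x = s \<odot>\<^bsub>M\<^esub> (a \<odot>\<^bsub>M\<^esub> h)"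
      unfolding f(2) h(2) using aR s h(1) by (simp add: smult_assoc1[symmetric] R.m_comm)
    then have "x = a \<odot>\<^bsub>M\<^esub> h" using colon_zero_cancel[OF s s_inj x] aR h(1) by blast
    then show "x \<in> scaled a (carrier M)" using h(1) by (auto simp: scaled_def)
  qed
  from nakayama_zero[OF a carrier_is_submodule this] show ?thesis by auto
qed

lemma nonzerodivisor_on_zeroth_quotient_iff:
  assumes "r \<in> carrier R"
  shows "nonzerodivisor_on R (quotient_module M (ideal_smult R (Idl {}) M)) r
    \<longleftrightarrow> colon {\<zero>\<^bsub>M\<^esub>} r \<subseteq> {\<zero>\<^bsub>M\<^esub>}"
  unfolding ideal_smult_Idl_empty by (rule nonzerodivisor_on_quotient_iff[OF submodule_zero assms])

lemma ideal_smult_Idl_singleton: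
  "r \<in> carrier R \<Longrightarrow> ideal_smult R (Idl {r}) M = scaled r (carrier M)"
  using ideal_smult_principal[of r] R.cgenideal_eq_genideal[of r] by simp

text \<open>
  If \<open>a\<close> is a nonzerodivisor, \<open>[a]\<close> is regular by Nakayama's lemma, and longer sequences are
  excluded by \<open>no_regular_pair\<close>.
\<close>

lemma depth_eq_1_iff:
  assumes a: "a \<in> \<mm>" and fin: "interval_length R M (scaled a (carrier M)) (carrier M) < \<infinity>"
    and ne: "carrier M \<noteq> {\<zero>\<^bsub>M\<^esub>}"
  shows "module_depth R \<mm> M = 1 \<longleftrightarrow> colon {\<zero>\<^bsub>M\<^esub>} a \<subseteq> {\<zero>\<^bsub>M\<^esub>}"
proof
  have aR: "a \<in> carrier R" by (rule maxideal_carrier[OF a])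
  let ?S = "{enat (length rs) | rs. set rs \<subseteq> \<mm> \<and> regular_sequence R M rs}"
  have head: "colon {\<zero>\<^bsub>M\<^esub>} (rs ! 0) \<subseteq> {\<zero>\<^bsub>M\<^esub>}"
    if "set rs \<subseteq> \<mm>" "regular_sequence R M rs" "length rs > 0" for rs
  proof -
    \<comment> \<open>the first condition concerns \<open>M/0\<close>, because the first 0 members generate the zero ideal\<close>
    have "nonzerodivisor_on R (quotient_module M (ideal_smult R (Idl {}) M)) (rs ! 0)"
      using that(2,3) unfolding regular_sequence_def by (auto dest!: spec[of _ 0])
    moreover have "rs ! 0 \<in> carrier R" using that(1) nth_mem[OF that(3)] maxideal_carrier by blast
    ultimately show ?thesis by (simp add: nonzerodivisor_on_zeroth_quotient_iff)
  qed
  {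
    assume depth: "module_depth R \<mm> M = 1"
    have "\<exists>rs. set rs \<subseteq> \<mm> \<and> regular_sequence R M rs \<and> length rs > 0"
    proof (rule ccontr)
      assume "\<not> ?thesis"
      then have "module_depth R \<mm> M \<le> 0"
        unfolding module_depth_def by (intro Sup_least) (auto simp: zero_enat_def)
      with depth show False by simp
    qed
    then obtain rs where rs: "set rs \<subseteq> \<mm>" "regular_sequence R M rs" "length rs > 0" by blast
    have "rs ! 0 \<in> \<mm>" using rs by auto
    from nonzerodivisor_parameter[OF aR fin this head[OF rs]]
    show "colon {\<zero>\<^bsub>M\<^esub>} a \<subseteq> {\<zero>\<^bsub>M\<^esub>}" .
  next
    assume inj: "colon {\<zero>\<^bsub>M\<^esub>} a \<subseteq> {\<zero>\<^bsub>M\<^esub>}"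
    have "scaled a (carrier M) \<noteq> carrier M"
      using nakayama_zero[OF a carrier_is_submodule] ne M.zero_closed by auto
    then have "regular_sequence R M [a]"
      using inj by (simp add: regular_sequence_def nonzerodivisor_on_zeroth_quotient_iff[OF aR]
          ideal_smult_Idl_singleton[OF aR])
    then have "enat (length [a]) \<in> ?S" using a by (intro CollectI exI[of _ "[a]"]) simp
    then have "enat (length [a]) \<le> module_depth R \<mm> M"
      unfolding module_depth_def by (rule Sup_upper)
    moreover have "module_depth R \<mm> M \<le> 1"
      unfolding module_depth_def
    proof (rule Sup_least, clarify)
      fix rs assume rs: "set rs \<subseteq> \<mm>" "regular_sequence R M rs"
      have "length rs \<le> 1"
      proof (rule ccontr)
        assume "\<not> length rs \<le> 1"
        then have len: "length rs > 1" by simp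
        let ?b = "rs ! 0" and ?r = "rs ! 1"
        have in_m: "?b \<in> \<mm>" "?r \<in> \<mm>"
          using len by (auto intro!: subsetD[OF rs(1)] nth_mem)
        have b: "?b \<in> carrier R" and r: "?r \<in> carrier R" using in_m maxideal_carrier by auto
        have take1: "set (take 1 rs) = {?b}" using len by (cases rs) auto
        have "nonzerodivisor_on R (quotient_module M (ideal_smult R (Idl (set (take 1 rs))) M)) ?r"
          using rs(2) len unfolding regular_sequence_def by blast
        then have "colon (scaled ?b (carrier M)) ?r \<subseteq> scaled ?b (carrier M)"
          unfolding take1 ideal_smult_Idl_singleton[OF b]
          using nonzerodivisor_on_quotient_iff[OF submodule_scaled[OF b carrier_is_submodule] r] by simp
        moreover have "length rs > 0" using len by linarith
        ultimately show False
          using no_regular_pair[OF a fin in_m(1) head[OF rs] in_m(2)] ne by blast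
      qed
      then show "enat (length rs) \<le> 1" by (simp add: one_enat_def)
    qed
    ultimately show "module_depth R \<mm> M = 1" by (simp add: one_enat_def antisym)
  }
qed

end


section \<open>The Hilbert polynomial of a parameter\<close>

lemma hilbert_polyI:
  fixes P :: "rat poly"
  assumes ev: "\<forall>\<^sub>F n in sequentially. \<exists>k.
      module_length R (quotient_module M (ideal_smult R (I [^]\<^bsub>ideals_set R\<^esub> n) M)) = enat k \<and>
      poly P (of_nat n) = of_nat k"
  shows "hilbert_poly R I M = P"
  unfolding hilbert_poly_def
proof (rule the_equality, rule ev)
  fix Q :: "rat poly" assume "\<forall>\<^sub>F n in sequentially. \<exists>k.
      module_length R (quotient_module M (ideal_smult R (I [^]\<^bsub>ideals_set R\<^esub> n) M)) = enat k \<and>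
      poly Q (of_nat n) = of_nat k"
  with ev have "\<forall>\<^sub>F n in sequentially. poly (Q - P) (of_nat n) = 0"
    by eventually_elim auto
  then obtain N where N: "\<And>n. n \<ge> N \<Longrightarrow> poly (Q - P) (of_nat n) = 0"
    by (auto simp: eventually_sequentially)
  have "infinite (of_nat ` {N..} :: rat set)"
    by (simp add: finite_image_iff inj_on_def infinite_Ici)
  moreover have "of_nat ` {N..} \<subseteq> {x. poly (Q - P) x = 0}" using N by auto
  ultimately have "infinite {x. poly (Q - P) x = 0}" by (metis finite_subset)
  then show "Q = P" using poly_roots_finite[of "Q - P"] by auto
qed

text \<open>
  For dimension 1 the binomial coefficients in the definition are \<open>x\<close> and 1, so the values of
  the polynomial at 0 and 1 determine the coefficients.
\<close>

lemma hilbert_coeff_1I: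
  fixes e0 e1 :: int
  assumes dim: "module_dim R M = 1"
    and poly: "hilbert_poly R I M = [:- of_int e1, of_int e0:]"
  shows "hilbert_coeff R I M 1 = e1"
proof -
  have expand: "(\<Sum>i\<le>1. (- 1) ^ i * of_int (e i) * ((x + of_nat (1 - i) - 1) gchoose (1 - i)))
      = of_int (e 0) * x - of_int (e 1)" for e :: "nat \<Rightarrow> int" and x :: rat
    by simp
  have "hilbert_coeff R I M = (THE e. (\<forall>i>1. e i = 0) \<and>
      (\<forall>x::rat. - of_int e1 + x * of_int e0 = of_int (e 0) * x - of_int (e 1)))"
    unfolding hilbert_coeff_def dim Let_def poly
    by (simp add: one_enat_def expand[simplified])
  also have "\<dots> = (\<lambda>i. if i = 0 then e0 else if i = 1 then e1 else 0)"
  proof (rule the_equality)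
    fix e :: "nat \<Rightarrow> int"
    assume e: "(\<forall>i>1. e i = 0) \<and>
      (\<forall>x::rat. - of_int e1 + x * of_int e0 = of_int (e 0) * x - of_int (e 1))"
    then have "(- of_int e1 :: rat) + 0 * of_int e0 = of_int (e 0) * 0 - of_int (e 1)"
      "(- of_int e1 :: rat) + 1 * of_int e0 = of_int (e 0) * 1 - of_int (e 1)" by blast+
    then have "e 1 = e1" "e 0 = e0" by simp_all
    then show "e = (\<lambda>i. if i = 0 then e0 else if i = 1 then e1 else 0)"
      using e by (intro ext) auto
  qed auto
  finally show ?thesis by simp
qed

text \<open>
  The annihilator is the whole ring, and the zero ring has no prime ideals, so the supremum is
  taken over the empty set.
\<close>

lemma (in module) module_dim_zero_module:
  assumes "carrier M = {\<zero>\<^bsub>M\<^esub>}"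
  shows "module_dim R M = 0"
proof -
  have ann: "annihilator R M = carrier R" using assms by (auto simp: annihilator_def)
  have coset: "carrier R +> x = carrier R" if "x \<in> carrier R" for x
    using that R.a_coset_join2[of x "carrier R"] additive_subgroup.a_subgroup[OF ideal.axioms(1)[OF R.oneideal]]
    by simp
  then have single: "carrier (R Quot carrier R) = {carrier R}"
    by (auto simp: FactRing_def A_RCOSETS_def')
  have no_prime: "\<not> primeideal P (R Quot carrier R)" for P
  proof
    assume "primeideal P (R Quot carrier R)"
    then interpret P: primeideal P "R Quot carrier R" .
    have "\<zero>\<^bsub>R Quot carrier R\<^esub> = carrier R" by (simp add: FactRing_def)
    from additive_subgroup.zero_closed[OF P.additive_subgroup_axioms, unfolded this] have "carrier R \<in> P" .
    moreover from P.a_subset[unfolded single] have "P \<subseteq> {carrier R}" .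
    ultimately have "P = {carrier R}" by (metis empty_iff subset_singletonD)
    with P.I_notcarr single show False by metis
  qed
  have "krull_dim (R Quot carrier R) \<le> 0"
    unfolding krull_dim_def by (rule Sup_least) (use no_prime in blast)
  then show ?thesis unfolding module_dim_def ann by simp
qed

context module
begin

lemma scaled_add_kernel:
  assumes b: "b \<in> carrier R" and N: "submodule N R M"
  shows "scaled b (N <+>\<^bsub>M\<^esub> colon {\<zero>\<^bsub>M\<^esub>} b) = scaled b N"
proof
  have NM: "N \<subseteq> carrier M" by (rule submoduleE(1)[OF N])
  show "scaled b (N <+>\<^bsub>M\<^esub> colon {\<zero>\<^bsub>M\<^esub>} b) \<subseteq> scaled b N"
    using b NM by (auto simp: scaled_def colon_def smult_r_distr subsetD elim!: set_add_memE)
  show "scaled b N \<subseteq> scaled b (N <+>\<^bsub>M\<^esub> colon {\<zero>\<^bsub>M\<^esub>} b)"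
    by (intro scaled_mono set_add_upper(1)[OF N] submodule_colon[OF b submodule_zero])
qed

text \<open>
  Multiplication by \<open>a\<^sup>i\<close> maps \<open>M\<close> onto \<open>a\<^sup>iM\<close>, and the preimage of \<open>a\<^sup>i\<^sup>+\<^sup>1M\<close> is the sum of
  \<open>aM\<close> and the kernel of \<open>a\<^sup>i\<close>.
\<close>

lemma interval_length_consecutive_multiples:
  assumes a: "a \<in> carrier R"
  shows "interval_length R M (scaled (a [^] Suc i) (carrier M)) (scaled (a [^] i) (carrier M))
    = interval_length R M (scaled a (carrier M) <+>\<^bsub>M\<^esub> colon {\<zero>\<^bsub>M\<^esub>} (a [^] i)) (carrier M)"
proof -
  let ?A = "scaled a (carrier M)" and ?K = "colon {\<zero>\<^bsub>M\<^esub>} (a [^] i)"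
  have ai: "a [^] i \<in> carrier R" using a by simp
  have A: "submodule ?A R M" by (rule submodule_scaled[OF a carrier_is_submodule])
  have K: "submodule ?K R M" by (rule submodule_colon[OF ai submodule_zero])
  have "scaled (a [^] Suc i) (carrier M) = scaled (a [^] i) (?A <+>\<^bsub>M\<^esub> ?K)"
    using scaled_add_kernel[OF ai A] scaled_mult[OF ai a order_refl] by simp
  with interval_length_scaled[OF ai submodule_add[OF A K] set_add_upper(2)[OF A K]]
  show ?thesis by simp
qed

lemma interval_length_multiples_sum:
  assumes a: "a \<in> carrier R"
    and l: "\<And>i. interval_length R M (scaled (a [^] Suc i) (carrier M)) (scaled (a [^] i) (carrier M))
      = enat (l i)"
  shows "interval_length R M (scaled (a [^] n) (carrier M)) (carrier M) = enat (\<Sum>i<n. l i)"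
proof (induction n)
  case 0
  have "scaled (a [^] (0::nat)) (carrier M) = carrier M" by (force simp: scaled_def)
  then show ?case by (simp add: interval_length_self[OF carrier_is_submodule] zero_enat_def)
next
  case (Suc n)
  note S = submodule_scaled_pow[OF a]
  have "scaled (a [^] Suc n) (carrier M) \<subseteq> scaled (a [^] n) (carrier M)"
    unfolding scaled_pow_Suc[OF a order_refl] by (rule scaled_subset[OF a S])
  from interval_length_add[OF S S carrier_is_submodule this submoduleE(1)[OF S]] l[of n] Suc
  show ?case by (simp add: add.commute)
qed

end

context noetherian_local_module
begin

text \<open>
  Here \<open>l i\<close> is the length of \<open>M/(aM + W\<^sub>i)\<close>, where \<open>W\<^sub>i\<close> is the kernel of \<open>a\<^sup>i\<close>, and \<open>c\<close> is an
  index from which \<open>W\<^sub>i\<close> is constant. Equality of \<open>l 0\<close> and \<open>l c\<close> forces \<open>W\<^sub>c \<subseteq> aM\<close> by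
  additivity of length, and then \<open>torsion_in_multiples_zero\<close> applies.
\<close>

lemma hilbert_function_of_parameter:
  assumes a: "a \<in> \<mm>" and fin: "interval_length R M (scaled a (carrier M)) (carrier M) < \<infinity>"
  obtains l :: "nat \<Rightarrow> nat" and c :: nat where
    "\<And>n. interval_length R M (scaled (a [^] n) (carrier M)) (carrier M) = enat (\<Sum>i<n. l i)"
    "\<And>i. i \<ge> c \<Longrightarrow> l i = l c" "\<And>i. l c \<le> l i" "\<And>i. l i \<le> l 0"
    "colon {\<zero>\<^bsub>M\<^esub>} a \<subseteq> {\<zero>\<^bsub>M\<^esub>} \<longleftrightarrow> l 0 = l c"
proof -
  have aR: "a \<in> carrier R" by (rule maxideal_carrier[OF a])
  let ?A = "scaled a (carrier M)"
  let ?W = "\<lambda>i::nat. colon {\<zero>\<^bsub>M\<^esub>} (a [^] i)"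
  have A: "submodule ?A R M" by (rule submodule_scaled[OF aR carrier_is_submodule])
  have W: "submodule (?W i) R M" for i using aR by (intro submodule_colon submodule_zero) simp
  have AW: "submodule (?A <+>\<^bsub>M\<^esub> ?W i) R M" for i by (rule submodule_add[OF A W])
  obtain c where c: "c > 0" "\<And>i. i \<ge> c \<Longrightarrow> ?W i = ?W c" by (rule torsion_stabilizes[OF aR]) blast
  have mono: "?W i \<subseteq> ?W j" if "i \<le> j" for i j
    using lift_Suc_mono_le[of ?W, OF colon_pow_mono[OF aR] that] .
  define l where "l i = the_enat (interval_length R M (?A <+>\<^bsub>M\<^esub> ?W i) (carrier M))" for i
  have l: "interval_length R M (?A <+>\<^bsub>M\<^esub> ?W i) (carrier M) = enat (l i)" for i
  proof -
    have "interval_length R M (?A <+>\<^bsub>M\<^esub> ?W i) (carrier M) \<le> interval_length R M ?A (carrier M)"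
      by (intro interval_length_mono set_add_upper(1)[OF A W]) simp
    with fin show ?thesis unfolding l_def by (cases "interval_length R M (?A <+>\<^bsub>M\<^esub> ?W i) (carrier M)") auto
  qed
  have W0: "?W 0 = {\<zero>\<^bsub>M\<^esub>}" by (auto simp: colon_def)
  have A0: "?A <+>\<^bsub>M\<^esub> ?W 0 = ?A"
    unfolding W0 using set_add_least[OF A order_refl, of "{\<zero>\<^bsub>M\<^esub>}"] submodule_has_zero[OF A]
      set_add_upper(1)[OF A submodule_zero] by auto
  show ?thesis
  proof (rule that[of l c])
    show "interval_length R M (scaled (a [^] n) (carrier M)) (carrier M) = enat (\<Sum>i<n. l i)" for n
      by (rule interval_length_multiples_sum[OF aR])
         (simp only: interval_length_consecutive_multiples[OF aR] l)
    show "l i = l c" if "i \<ge> c" for i using c(2)[OF that] by (simp add: l_def)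
    show "l c \<le> l i" for i
    proof -
      have "?W i \<subseteq> ?W c" using mono[of i c] c(2)[of i] by (cases "i \<le> c") auto
      then have "?A <+>\<^bsub>M\<^esub> ?W i \<subseteq> ?A <+>\<^bsub>M\<^esub> ?W c"
        by (auto elim!: set_add_memE intro: set_add_memI)
      from interval_length_mono[OF this order_refl, of R M "carrier M"] show ?thesis by (simp add: l)
    qed
    show "l i \<le> l 0" for i
    proof -
      have "interval_length R M (?A <+>\<^bsub>M\<^esub> ?W i) (carrier M) \<le> interval_length R M ?A (carrier M)"
        by (intro interval_length_mono set_add_upper(1)[OF A W]) simp
      then show ?thesis using l[of 0] l[of i] unfolding A0 by simp
    qed
    show "colon {\<zero>\<^bsub>M\<^esub>} a \<subseteq> {\<zero>\<^bsub>M\<^esub>} \<longleftrightarrow> l 0 = l c"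
    proof
      assume "colon {\<zero>\<^bsub>M\<^esub>} a \<subseteq> {\<zero>\<^bsub>M\<^esub>}"
      then have "?W c \<subseteq> {\<zero>\<^bsub>M\<^esub>}" by (rule colon_pow_subset[OF aR]) simp
      then have "?W c = ?W 0" using submodule_has_zero[OF W] W0 by auto
      then show "l 0 = l c" by (simp add: l_def)
    next
      assume eq: "l 0 = l c"
      have "interval_length R M ?A (carrier M)
          = interval_length R M ?A (?A <+>\<^bsub>M\<^esub> ?W c) + interval_length R M (?A <+>\<^bsub>M\<^esub> ?W c) (carrier M)"
        by (rule interval_length_add[OF A AW carrier_is_submodule set_add_upper(1)[OF A W] submoduleE(1)[OF AW]])
      then have "interval_length R M ?A (?A <+>\<^bsub>M\<^esub> ?W c) = 0"
        using l[of 0] l[of c] eq A0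
        by (cases "interval_length R M ?A (?A <+>\<^bsub>M\<^esub> ?W c)") (auto simp: zero_enat_def)
      then have "?A = ?A <+>\<^bsub>M\<^esub> ?W c"
        by (rule interval_length_eq_0D[OF A AW set_add_upper(1)[OF A W]])
      then have "?W c \<subseteq> ?A" using set_add_upper(2)[OF A W] by blast
      then have "?W c \<subseteq> {\<zero>\<^bsub>M\<^esub>}"
        using torsion_in_multiples_zero[OF a c(2)[of "Suc c"]] by simp
      moreover have "?W 1 \<subseteq> ?W c" using c(1) by (intro mono) simp
      ultimately show "colon {\<zero>\<^bsub>M\<^esub>} a \<subseteq> {\<zero>\<^bsub>M\<^esub>}" using aR by simp
    qed
  qed
qed

text \<open>
  For \<open>n \<ge> c\<close> the length of \<open>M/a\<^sup>nM\<close> is the sum of \<open>l i\<close> over \<open>i < c\<close> plus \<open>(n - c) l c\<close>.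
  Reading off the constant term gives \<open>e\<^sub>1\<close> as a sum of the numbers \<open>l c - l i \<le> 0\<close>, which
  includes the index 0 unless \<open>c = 0\<close>.
\<close>

lemma e1_neg_iff_zerodivisor:
  assumes a: "a \<in> \<mm>" and fin: "interval_length R M (scaled a (carrier M)) (carrier M) < \<infinity>"
    and dim: "module_dim R M = 1"
  shows "hilbert_coeff R (PIdl a) M 1 < 0 \<longleftrightarrow> \<not> colon {\<zero>\<^bsub>M\<^esub>} a \<subseteq> {\<zero>\<^bsub>M\<^esub>}"
proof -
  have aR: "a \<in> carrier R" by (rule maxideal_carrier[OF a])
  obtain l :: "nat \<Rightarrow> nat" and c :: nat where
    len: "\<And>n. interval_length R M (scaled (a [^] n) (carrier M)) (carrier M) = enat (\<Sum>i<n. l i)"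
    and stable: "\<And>i. i \<ge> c \<Longrightarrow> l i = l c" and le: "\<And>i. l c \<le> l i" "\<And>i. l i \<le> l 0"
    and nzd: "colon {\<zero>\<^bsub>M\<^esub>} a \<subseteq> {\<zero>\<^bsub>M\<^esub>} \<longleftrightarrow> l 0 = l c"
    using hilbert_function_of_parameter[OF a fin] by metis
  define e1 where "e1 = (\<Sum>i<c. int (l c) - int (l i))"
  let ?P = "[:- of_int e1, of_int (int (l c)):] :: rat poly"
  have sum: "int (\<Sum>i<n. l i) = int (l c) * int n - e1" if "n \<ge> c" for n
    using that
  proof (induction n rule: dec_induct)
    case base
    show ?case by (simp add: e1_def sum_subtractf)
  next
    case (step n)
    then show ?case using stable[of n] by (simp add: algebra_simps)
  qed
  have "hilbert_poly R (PIdl a) M = ?P"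
  proof (rule hilbert_polyI)
    show "\<forall>\<^sub>F n in sequentially. \<exists>k.
        module_length R (quotient_module M (ideal_smult R (PIdl a [^]\<^bsub>ideals_set R\<^esub> n) M)) = enat k \<and>
        poly ?P (of_nat n) = of_nat k"
      using eventually_ge_at_top[of c]
    proof eventually_elim
      case (elim n)
      have an: "a [^] n \<in> carrier R" using aR by simp
      have "module_length R (quotient_module M (ideal_smult R (PIdl a [^]\<^bsub>ideals_set R\<^esub> n) M))
          = enat (\<Sum>i<n. l i)"
        unfolding R.cgenideal_pow[OF aR] ideal_smult_principal[OF an] len[symmetric]
        by (rule module_length_quotient[OF submodule_scaled_pow[OF aR]])
      moreover have "poly ?P (of_nat n) = rat_of_int (int (l c) * int n - e1)" by simp
      then have "poly ?P (of_nat n) = of_nat (\<Sum>i<n. l i)"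
        unfolding sum[OF elim, symmetric] by simp
      ultimately show ?case by blast
    qed
  qed
  from hilbert_coeff_1I[OF dim this] have coeff: "hilbert_coeff R (PIdl a) M 1 = e1" .
  have nonpos: "int (l c) - int (l i) \<le> 0" for i using le(1)[of i] by simp
  show ?thesis
  proof (cases "l 0 = l c")
    case True
    have "int (l c) - int (l i) = 0" for i using le[of i] True by simp
    then have "e1 = 0" unfolding e1_def by (intro sum.neutral ballI)
    then show ?thesis using coeff nzd True by simp
  next
    case False
    then have "c > 0" by (cases c) auto
    have "e1 \<le> int (l c) - int (l 0)"
      unfolding e1_def using \<open>c > 0\<close> nonpos
      by (simp add: sum.remove[of "{..<c}" 0] sum_nonpos)
    also have "\<dots> < 0" using False le(1)[of 0] by simp
    finally show ?thesis using coeff nzd False by simp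
  qed
qed

end

theorem proposition2:
  fixes R :: "('a, 'r) ring_scheme"
    and M :: "('a, 'b, 'm) module_scheme"
    and \<mm> :: "'a set"
    and a :: 'a
  assumes "noetherian_local_ring \<mm> R"
    and "module R M"
    and "finitely_generated_module R M"
    and "module_dim R M = 1"
    and "a \<in> \<mm>"
    and "module_length R (quotient_module M (ideal_smult R (PIdl\<^bsub>R\<^esub> a) M)) < \<infinity>"
  shows "hilbert_coeff R (PIdl\<^bsub>R\<^esub> a) M 1 < 0 \<longleftrightarrow> \<not> cohen_macaulay_module R \<mm> M"
proof -
  interpret noetherian_local_ring \<mm> R by fact
  interpret module R M by fact
  interpret noetherian_local_module \<mm> R M
    by unfold_locales (rule assms(3))
  have aR: "a \<in> carrier R" by (rule maxideal_carrier[OF assms(5)])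
  have fin: "interval_length R M (scaled a (carrier M)) (carrier M) < \<infinity>"
    using assms(6) unfolding ideal_smult_principal[OF aR]
      module_length_quotient[OF submodule_scaled[OF aR carrier_is_submodule]] .
  have ne: "carrier M \<noteq> {\<zero>\<^bsub>M\<^esub>}" using module_dim_zero_module assms(4) by auto
  then have "cohen_macaulay_module R \<mm> M \<longleftrightarrow> colon {\<zero>\<^bsub>M\<^esub>} a \<subseteq> {\<zero>\<^bsub>M\<^esub>}"
    unfolding cohen_macaulay_module_def assms(4) using depth_eq_1_iff[OF assms(5) fin ne] by simp
  then show ?thesis using e1_neg_iff_zerodivisor[OF assms(5) fin assms(4)] by simp
qed

end
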